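(* Let $\ell\ge1$ and $\underline\lambda,\underline x\in\mathbb R^{\ell+1}$. The elementary $\mathfrak{gl}_{\ell+1}$-Whittaker function is the limit $$\Psi^{(0)}_{\underline\lambda}(\underline x)=\lim_{\hbar\to\infty}\hbar^{-\ell(\ell+1)/2}\,\Psi_{\underline\lambda}(\hbar\underline x,\hbar)$$ of the classical $\mathfrak{gl}_{\ell+1}$-Whittaker function $\Psi_{\underline\lambda}(\underline x,\hbar)$.
   Context: $i=\sqrt{-1}$, $\hbar>0$, $\Gamma_1(z|\hbar)=\hbar^{z/\hbar}\,\Gamma(z/\hbar)$. In both integrals below $(s,p)$ runs over ordered pairs of distinct indices in $\{1,\dots,n\}$, $\gamma_{\ell+1,j}:=\lambda_j$, $\gamma_{n,j}:=0$ for $j>n$, and $\mathcal S$ means that each $\gamma_{n,j}$ ($1\le j\le n\le\ell$) runs over a horizontal line $\mathbb R-i\varepsilon_{n,j}$ with fixed real $\varepsilon_{n,j}$ chosen so that $\max_j\mathrm{Im}\,\gamma_{k,j}<\min_m\mathrm{Im}\,\gamma_{k+1,m}$ for $k=1,\dots,\ell$. Classical $\mathfrak{gl}_{\ell+1}$-Whittaker function: $$\Psi_{\underline\lambda}(\underline x,\hbar)=\int_{\mathcal S}\prod_{n=1}^{\ell}\frac{\prod_{k=1}^{n+1}\prod_{m=1}^{n}\Gamma_1\big(\tfrac{\gamma_{n+1,k}-\gamma_{n,m}}{i}\big|\hbar\big)}{n!\prod_{s\ne p}\Gamma_1\big(\tfrac{\gamma_{n,s}-\gamma_{n,p}}{i}\big|\hbar\big)}\;e^{\frac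 i\hbar\sum_{n=1}^{\ell+1}\sum_{j=1}^{n}(\gamma_{n,j}-\gamma_{n-1,j})x_n}\prod_{n=1}^{\ell}\prod_{j=1}^{n}\frac{d\gamma_{n,j}}{2\pi\hbar}.$$ Elementary $\mathfrak{gl}_{\ell+1}$-Whittaker function: $$\Psi^{(0)}_{\underline\lambda}(\underline x)= i^{-\ell(\ell+1)/2}\int_{\mathcal S}\prod_{n=1}^{\ell}\frac{\prod_{s\ne p}(\gamma_{n,s}-\gamma_{n,p})}{n!\prod_{k=1}^n\prod_{m=1}^{n+1}(\gamma_{n,k}-\gamma_{n+1,m})}\; e^{i\sum_{n=1}^{\ell+1}\sum_{j=1}^n(\gamma_{n,j}-\gamma_{n-1,j})x_n}\prod_{n=1}^\ell\prod_{j=1}^n\frac{d\gamma_{n,j}}{2\pi i}.$$ *)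

theory Defs
  imports "HOL-Analysis.Analysis"
begin

definition Gamma1 :: "complex \<Rightarrow> real \<Rightarrow> complex" where
  "Gamma1 z h = of_real h powr (z / of_real h) * Gamma (z / of_real h)"

text \<open>
  The variables are indexed by pairs \<open>(n, j)\<close> with \<open>1 \<le> j \<le> n \<le> l\<close>.
  Vectors in \<open>l + 1\<close>-dimensional real space are functions on \<open>nat\<close> of which only the
  values at \<open>1, \<dots>, l + 1\<close> are used.
\<close>

definition triangle :: "nat \<Rightarrow> (nat \<times> nat) set" where
  "triangle l = (SIGMA n:{1..l}. {1..n})"

text \<open>
  The line on which the variable \<open>(n, j)\<close> runs is parametrised by the real part
  \<open>t (n, j)\<close>; row \<open>l + 1\<close> is \<open>lam\<close> and entries with \<open>j > n\<close> are zero.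
\<close>

definition gam ::
  "nat \<Rightarrow> (nat \<Rightarrow> real) \<Rightarrow> (nat \<times> nat \<Rightarrow> real) \<Rightarrow> (nat \<times> nat \<Rightarrow> real) \<Rightarrow> nat \<Rightarrow> nat \<Rightarrow> complex"
where
  "gam l lam eps t n j =
     (if j > n then 0
      else if n = l + 1 then of_real (lam j)
      else of_real (t (n, j)) - \<i> * of_real (eps (n, j)))"

text \<open>The imaginary parts compared here do not depend on \<open>t\<close> or on the real vector \<open>lam\<close>.\<close>

definition admissible :: "nat \<Rightarrow> (nat \<Rightarrow> real) \<Rightarrow> (nat \<times> nat \<Rightarrow> real) \<Rightarrow> bool" where
  "admissible l lam eps \<longleftrightarrow>
     (\<forall>t. \<forall>k\<in>{1..l}.
        Max ((\<lambda>j. Im (gam l lam eps t k j)) ` {1..k})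
          < Min ((\<lambda>m. Im (gam l lam eps t (k + 1) m)) ` {1..k + 1}))"

definition distinct_pairs :: "nat \<Rightarrow> (nat \<times> nat) set" where
  "distinct_pairs n = {(s, p). s \<in> {1..n} \<and> p \<in> {1..n} \<and> s \<noteq> p}"

definition phase ::
  "nat \<Rightarrow> (nat \<Rightarrow> real) \<Rightarrow> (nat \<Rightarrow> nat \<Rightarrow> complex) \<Rightarrow> complex" where
  "phase l x g = (\<Sum>n=1..l + 1. \<Sum>j=1..n. (g n j - g (n - 1) j) * of_real (x n))"

text \<open>
  Along horizontal lines the complex differential of each variable is the Lebesgue measure
  \<open>dt\<close>, so the iterated contour integrals are integrals over the product of the lines.
  Where a Gamma factor in the denominator has a pole, \<open>Gamma\<close> and division by zero both
  return zero, which is the correct value of the reciprocal Gamma function.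
\<close>

definition classical_whittaker ::
  "nat \<Rightarrow> (nat \<times> nat \<Rightarrow> real) \<Rightarrow> (nat \<Rightarrow> real) \<Rightarrow> (nat \<Rightarrow> real) \<Rightarrow> real \<Rightarrow> complex"
where
  "classical_whittaker l eps lam x h =
     (LINT t | Pi\<^sub>M (triangle l) (\<lambda>_. lborel).
        (let g = gam l lam eps t in
           (\<Prod>n=1..l.
              (\<Prod>k=1..n + 1. \<Prod>m=1..n. Gamma1 ((g (n + 1) k - g n m) / \<i>) h)
              / (fact n * (\<Prod>(s, p)\<in>distinct_pairs n. Gamma1 ((g n s - g n p) / \<i>) h)))
           * exp (\<i> / of_real h * phase l x g)
           * (\<Prod>n=1..l. \<Prod>j=1..n. 1 / (2 * of_real pi * of_real h))))"

text \<open>The exponent \<open>l * (l + 1) div 2\<close> is an exact division.\<close>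

definition elementary_whittaker ::
  "nat \<Rightarrow> (nat \<times> nat \<Rightarrow> real) \<Rightarrow> (nat \<Rightarrow> real) \<Rightarrow> (nat \<Rightarrow> real) \<Rightarrow> complex"
where
  "elementary_whittaker l eps lam x =
     \<i> powi (- int (l * (l + 1) div 2)) *
     (LINT t | Pi\<^sub>M (triangle l) (\<lambda>_. lborel).
        (let g = gam l lam eps t in
           (\<Prod>n=1..l.
              (\<Prod>(s, p)\<in>distinct_pairs n. g n s - g n p)
              / (fact n * (\<Prod>k=1..n. \<Prod>m=1..n + 1. g n k - g (n + 1) m)))
           * exp (\<i> * phase l x g)
           * (\<Prod>n=1..l. \<Prod>j=1..n. 1 / (2 * of_real pi * \<i>))))"

end

theory Submission
  imports Defs
begin

text \<open>
  As \<open>h\<close> tends to infinity, \<open>Gamma1 z h / h\<close> tends to \<open>1 / z\<close>, because \<open>Gamma\<close> has a simple pole with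
  residue 1 at 0 and \<open>h powr (z / h)\<close> tends to 1. After the powers of \<open>h\<close> have been cancelled
  (\<open>classical_whittaker_rescaled\<close>), the integrand of the classical function therefore converges
  pointwise to that of the elementary one (\<open>gt_integrand_rescaled_tendsto\<close>). The work lies in the
  majorant for dominated convergence. It has two parts.

  Firstly, each Gamma factor is its limit times a weight, and the product of all weights has to
  be bounded uniformly in \<open>h\<close> and in the variables. By the decay of \<open>Gamma\<close> on vertical lines,
  the logarithm of this product is \<open>- pi / (2 * h)\<close> times a sum of distances, with sign \<open>+\<close> between
  points of neighbouring rows and \<open>-\<close> within a row, up to logarithmic terms. Split
  over pairs of neighbouring rows, this becomes an energy that is nonnegative and bounds how far
  a point lies outside of the hull of the next row (\<open>abs_energy_coercive\<close>). Since the top row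
  is fixed, small energy confines the whole array, so the exponential beats the logarithmic terms (\<open>Gamma_weight_bounded\<close>).

  Secondly, the elementary integrand has to be absolutely integrable. Each row contributes a quotient of the shape of
  a Cauchy determinant, and this is bounded by a sum of products in which every variable is
  paired with a variable of the next row (\<open>log_row_decay\<close>). Borrowing small powers of the spread of the
  rows makes the decay in each of these distances integrable
  (\<open>log_energy_forest_bound\<close>). The variables then form a forest hanging from the fixed row,
  and such a product is integrated one variable at a time (\<open>nn_integral_forest\<close>).

  Both estimates rest on the same combinatorial lemma, \<open>ultrametric_matching\<close>: a greedy
  pairing of the points of two neighbouring rows, applied to \<open>max a b\<close> for the first part and to
  \<open>ln (1 + \<bar>a - b\<bar>)\<close> for the second.
\<close>


section \<open>Interaction energies of two neighbouring rows\<close>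

text \<open>
  Sums run over ordered pairs, so every unordered pair is counted twice; this matches the
  products over ordered pairs in the integrands.
\<close>

definition pair_energy :: "('p \<Rightarrow> 'p \<Rightarrow> real) \<Rightarrow> 'i set \<Rightarrow> ('i \<Rightarrow> 'p) \<Rightarrow> real" where
  "pair_energy f I x = (\<Sum>i\<in>I. \<Sum>j\<in>I - {i}. f (x i) (x j))"

text \<open>
  Opposite charges sit at the two rows \<open>x\<close> and \<open>y\<close>. For the interaction \<open>ln (1 + \<bar>a - b\<bar>)\<close>
  the exponential of its negative is the square of a bordered Cauchy determinant, with
  \<open>1 + \<bar>a - b\<bar>\<close> in place of \<open>a - b\<close>; for \<open>\<bar>a - b\<bar>\<close> it is proportional to the exponent in the
  decay of the Gamma factors of one row.
\<close>

definition cross_energy ::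
  "('p \<Rightarrow> 'p \<Rightarrow> real) \<Rightarrow> 'i set \<Rightarrow> ('i \<Rightarrow> 'p) \<Rightarrow> 'j set \<Rightarrow> ('j \<Rightarrow> 'p) \<Rightarrow> real" where
  "cross_energy f I x J y =
     2 * (\<Sum>i\<in>I. \<Sum>j\<in>J. f (x i) (y j)) - pair_energy f I x - pair_energy f J y"

lemma pair_energy_remove:
  assumes sym: "\<And>a b. f a b = f b a" and "finite I" "k \<in> I"
  shows "pair_energy f I x = pair_energy f (I - {k}) x + 2 * (\<Sum>i\<in>I - {k}. f (x i) (x k))"
proof -
  have "(\<Sum>i\<in>I - {k}. \<Sum>j\<in>I - {i}. f (x i) (x j))
      = (\<Sum>i\<in>I - {k}. f (x i) (x k) + (\<Sum>j\<in>I - {k} - {i}. f (x i) (x j)))"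
  proof (rule sum.cong)
    fix i assume i: "i \<in> I - {k}"
    have "I - {i} = insert k (I - {k} - {i})" using i assms by auto
    then show "(\<Sum>j\<in>I - {i}. f (x i) (x j))
      = f (x i) (x k) + (\<Sum>j\<in>I - {k} - {i}. f (x i) (x j))"
      using assms by (simp add: sum.insert_remove)
  qed simp
  moreover have "(\<Sum>j\<in>I - {k}. f (x k) (x j)) = (\<Sum>i\<in>I - {k}. f (x i) (x k))"
    using sym by (intro sum.cong) auto
  ultimately show ?thesis
    using assms by (simp add: pair_energy_def sum.remove[of I k] sum.distrib)
qed

text \<open>
  The greedy argument behind all estimates. Take the pair \<open>(x k, y m)\<close> that minimises \<open>f\<close>. By
  the ultrametric inequality, replacing \<open>x k\<close> by \<open>y m\<close> changes its interaction with any other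
  point by at most \<open>K\<close> in the unfavourable direction. Opposite charges therefore cancel, and
  the pair can be removed. The one point \<open>y v\<close> which is left over at the end is treated
  exactly in every step, since its interaction is what makes the resulting bound
  integrable (for the logarithm) and coercive (for the maximum).
\<close>

lemma ultrametric_matching:
  fixes f :: "'p \<Rightarrow> 'p \<Rightarrow> real" and x :: "'i \<Rightarrow> 'p" and y :: "'j \<Rightarrow> 'p"
  assumes sym: "\<And>a b. f a b = f b a"
    and ultra: "\<And>a b c. f a c \<le> max (f a b) (f b c) + K"
    and K: "K \<ge> 0"
    and fin: "finite I" "finite J" and card: "card J = Suc (card I)"
  shows "\<exists>\<sigma> v. v \<in> J \<and> \<sigma> ` I \<subseteq> J \<and>
           2 * (\<Sum>i\<in>I. f (x i) (y (\<sigma> i)) + f (x i) (y v) - f (y (\<sigma> i)) (y v))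
             - 2 * K * (real (card I))\<^sup>2 \<le> cross_energy f I x J y"
  using fin card
proof (induction "card I" arbitrary: I J)
  case 0
  then have "I = {}" by simp
  moreover obtain v where "J = {v}" using 0 by (metis card_1_singletonE One_nat_def)
  ultimately show ?case by (auto simp: cross_energy_def pair_energy_def)
next
  case (Suc n)
  have finI: "finite I" and finJ: "finite J" and cardI: "card I = Suc n"
    and cardJ: "card J = Suc (Suc n)"
    using Suc.prems Suc.hyps(2) by auto
  have ne: "I \<times> J \<noteq> {}" "finite (I \<times> J)" using finI finJ cardI cardJ by auto
  define F where "F = (\<lambda>(i, j). f (x i) (y j)) ` (I \<times> J)"
  have "Min F \<in> F" using ne by (intro Min_in) (auto simp: F_def)
  then obtain k m where km: "k \<in> I" "m \<in> J" and F_eq: "Min F = f (x k) (y m)"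
    by (auto simp: F_def)
  have least: "f (x k) (y m) \<le> f (x i) (y j)" if "i \<in> I" "j \<in> J" for i j
    unfolding F_eq[symmetric] using ne that by (intro Min_le) (auto simp: F_def)
  define I' where "I' = I - {k}"
  define J' where "J' = J - {m}"
  have fin': "finite I'" "finite J'" and cI: "card I' = n" and cJ: "card J' = Suc n"
    using finI finJ cardI cardJ km by (auto simp: I'_def J'_def)
  obtain \<sigma> v where v: "v \<in> J'" and \<sigma>: "\<sigma> ` I' \<subseteq> J'"
    and IH: "2 * (\<Sum>i\<in>I'. f (x i) (y (\<sigma> i)) + f (x i) (y v) - f (y (\<sigma> i)) (y v))
             - 2 * K * (real n)\<^sup>2 \<le> cross_energy f I' x J' y"
    using Suc.hyps(1)[OF cI[symmetric] fin'] cI cJ by auto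
  define \<tau> where "\<tau> = \<sigma>(k := m)"
  have kI: "k \<notin> I'" and Ieq: "I = insert k I'" and mJ: "m \<notin> J'" and Jeq: "J = insert m J'"
    using km by (auto simp: I'_def J'_def)
  \<comment> \<open>minimality of the chosen pair enters only here and in the next fact\<close>
  have near_x: "f (x i) (x k) - K \<le> f (x i) (y m)" if "i \<in> I'" for i
    using ultra[of "x i" "x k" "y m"] least[of i m] that km sym[of "y m" "x k"] Ieq by auto
  have near_y: "f (y j) (y m) - K \<le> f (x k) (y j)" if "j \<in> J'" for j
    using ultra[of "y j" "y m" "x k"] least[of k j] that km sym[of "y j" "x k"] Jeq by auto
  have sx: "(\<Sum>i\<in>I'. f (x i) (x k)) - real n * K \<le> (\<Sum>i\<in>I'. f (x i) (y m))"
    using sum_mono[of I' "\<lambda>i. f (x i) (x k) - K" "\<lambda>i. f (x i) (y m)"] near_x cI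
    by (simp add: sum_subtractf)
  have sy: "(\<Sum>j\<in>J' - {v}. f (y j) (y m)) - real n * K \<le> (\<Sum>j\<in>J' - {v}. f (x k) (y j))"
    using sum_mono[of "J' - {v}" "\<lambda>j. f (y j) (y m) - K" "\<lambda>j. f (x k) (y j)"] near_y cJ v fin'
    by (simp add: sum_subtractf)
  have cross: "(\<Sum>i\<in>I. \<Sum>j\<in>J. f (x i) (y j))
     = (\<Sum>i\<in>I'. \<Sum>j\<in>J'. f (x i) (y j)) + f (x k) (y m)
       + (\<Sum>i\<in>I'. f (x i) (y m)) + (f (x k) (y v) + (\<Sum>j\<in>J' - {v}. f (x k) (y j)))"
    using kI mJ fin' v by (simp add: Ieq Jeq sum.distrib sum.remove[of J' v "\<lambda>j. f (x k) (y j)"])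
  have px: "pair_energy f I x = pair_energy f I' x + 2 * (\<Sum>i\<in>I'. f (x i) (x k))"
    using pair_energy_remove[of f I k x, OF sym finI km(1)] by (simp add: I'_def)
  have py: "pair_energy f J y
      = pair_energy f J' y + 2 * (f (y v) (y m) + (\<Sum>j\<in>J' - {v}. f (y j) (y m)))"
    using pair_energy_remove[of f J m y, OF sym finJ km(2)] v fin'
    by (simp add: J'_def sum.remove[of _ v "\<lambda>j. f (y j) (y m)"])
  have arith: "2 * S - c \<le> 2 * (C + a + sm + (b + sj)) - (p + 2 * sk) - (q + 2 * (d + sv))"
    if "S = a + b - d + S'" "e + 4 * w \<le> c" "2 * S' - e \<le> 2 * C - p - q"
       "sk - w \<le> sm" "sv - w \<le> sj"
    for S S' C a b c d e p q w sm sj sk sv :: real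
    using that by (simp add: algebra_simps)
  have "(\<Sum>i\<in>I. f (x i) (y (\<tau> i)) + f (x i) (y v) - f (y (\<tau> i)) (y v))
      = f (x k) (y m) + f (x k) (y v) - f (y v) (y m)
        + (\<Sum>i\<in>I'. f (x i) (y (\<sigma> i)) + f (x i) (y v) - f (y (\<sigma> i)) (y v))"
  proof -
    have "(\<Sum>i\<in>I'. f (x i) (y (\<tau> i)) + f (x i) (y v) - f (y (\<tau> i)) (y v))
       = (\<Sum>i\<in>I'. f (x i) (y (\<sigma> i)) + f (x i) (y v) - f (y (\<sigma> i)) (y v))"
      using kI by (intro sum.cong) (auto simp: \<tau>_def)
    then show ?thesis using kI fin' sym[of "y v" "y m"] by (simp add: Ieq \<tau>_def)
  qed
  moreover have "2 * K * (real n)\<^sup>2 + 4 * (real n * K) \<le> 2 * K * (real (card I))\<^sup>2"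
    using K cardI by (simp add: power2_eq_square algebra_simps)
  ultimately have "2 * (\<Sum>i\<in>I. f (x i) (y (\<tau> i)) + f (x i) (y v) - f (y (\<tau> i)) (y v))
             - 2 * K * (real (card I))\<^sup>2 \<le> cross_energy f I x J y"
    using arith[OF _ _ IH[unfolded cross_energy_def] sx sy]
    unfolding cross_energy_def cross px py by blast
  moreover have "v \<in> J" "\<tau> ` I \<subseteq> J" using v \<sigma> km by (auto simp: \<tau>_def Ieq Jeq)
  ultimately show ?case by blast
qed

text \<open>
  The distance is not an ultrametric, but \<open>\<bar>a - b\<bar> = 2 * max a b - a - b\<close> and \<open>max\<close> obeys the
  ultrametric inequality with \<open>K = 0\<close>.
\<close>

lemma pair_energy_abs:
  fixes x :: "'i \<Rightarrow> real"
  assumes "finite I"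
  shows "pair_energy (\<lambda>a b. \<bar>a - b\<bar>) I x
           = 2 * pair_energy max I x - 2 * (real (card I) - 1) * sum x I"
proof -
  have "pair_energy (\<lambda>a b. \<bar>a - b\<bar>) I x
      = (\<Sum>i\<in>I. \<Sum>j\<in>I - {i}. 2 * max (x i) (x j) - (x i + x j))"
    unfolding pair_energy_def by (intro sum.cong) (auto simp: max_def abs_if)
  also have "\<dots> = (\<Sum>i\<in>I. 2 * (\<Sum>j\<in>I - {i}. max (x i) (x j))
                       - ((real (card I) - 1) * x i + (sum x I - x i)))"
  proof (rule sum.cong)
    fix i assume i: "i \<in> I"
    then have "card I \<ge> 1" using assms by (metis One_nat_def Suc_leI card_gt_0_iff empty_iff)
    then show "(\<Sum>j\<in>I - {i}. 2 * max (x i) (x j) - (x i + x j))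
        = 2 * (\<Sum>j\<in>I - {i}. max (x i) (x j)) - ((real (card I) - 1) * x i + (sum x I - x i))"
      using i assms
      by (simp add: sum_subtractf sum.distrib sum_distrib_left sum_diff1 of_nat_diff)
  qed simp
  also have "\<dots> = 2 * pair_energy max I x - 2 * (real (card I) - 1) * sum x I"
    by (simp add: pair_energy_def sum_subtractf sum.distrib sum_distrib_left[symmetric] sum_distrib_right[symmetric] algebra_simps)
  finally show ?thesis .
qed

text \<open>
  With \<open>f = max\<close>, the \<open>i\<close>-th summand of the matching bound minus \<open>x i\<close> is the distance from \<open>x i\<close>
  to the interval between \<open>y (\<sigma> i)\<close> and \<open>y v\<close>. The terms linear in the points turn the bound for
  \<open>max\<close> into one for \<open>\<bar>a - b\<bar>\<close>. Inside the hull of \<open>y\<close> no growth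
  can be expected, since the energy vanishes on interlacing rows.
\<close>

lemma abs_energy_coercive:
  fixes x :: "'i \<Rightarrow> real" and y :: "'j \<Rightarrow> real"
  assumes fin: "finite I" "finite J" and card: "card J = Suc (card I)"
    and B: "\<And>j. j \<in> J \<Longrightarrow> \<bar>y j\<bar> \<le> B"
  shows "cross_energy (\<lambda>a b. \<bar>a - b\<bar>) I x J y \<ge> 0"
    and "i \<in> I \<Longrightarrow> \<bar>x i\<bar> \<le> B + cross_energy (\<lambda>a b. \<bar>a - b\<bar>) I x J y"
proof -
  have "\<exists>\<sigma> v. v \<in> J \<and> \<sigma> ` I \<subseteq> J \<and>
           2 * (\<Sum>i\<in>I. max (x i) (y (\<sigma> i)) + max (x i) (y v) - max (y (\<sigma> i)) (y v))
             - 2 * 0 * (real (card I))\<^sup>2 \<le> cross_energy max I x J y"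
    by (rule ultrametric_matching) (use fin card in \<open>auto simp: max_def\<close>)
  then obtain \<sigma> v where v: "v \<in> J" and \<sigma>: "\<sigma> ` I \<subseteq> J" and
    le: "2 * (\<Sum>i\<in>I. max (x i) (y (\<sigma> i)) + max (x i) (y v) - max (y (\<sigma> i)) (y v))
           \<le> cross_energy max I x J y" by auto
  let ?d = "\<lambda>i. max (x i) (y (\<sigma> i)) + max (x i) (y v) - max (y (\<sigma> i)) (y v) - x i"
  have "(\<Sum>i\<in>I. \<Sum>j\<in>J. \<bar>x i - y j\<bar>) = (\<Sum>i\<in>I. \<Sum>j\<in>J. 2 * max (x i) (y j) - x i - y j)"
    by (intro sum.cong) (auto simp: max_def abs_if)
  also have "\<dots> = 2 * (\<Sum>i\<in>I. \<Sum>j\<in>J. max (x i) (y j))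
      - real (card J) * sum x I - real (card I) * sum y J"
    by (simp add: sum_subtractf sum_distrib_left)
  finally have "cross_energy (\<lambda>a b. \<bar>a - b\<bar>) I x J y
     = 2 * cross_energy max I x J y - 4 * sum x I"
    using card by (simp add: cross_energy_def pair_energy_abs fin algebra_simps)
  then have E: "cross_energy (\<lambda>a b. \<bar>a - b\<bar>) I x J y \<ge> 4 * (\<Sum>i\<in>I. ?d i)"
    using le by (simp add: sum_subtractf)
  have d0: "?d i \<ge> 0" for i by (auto simp: max_def)
  have dB: "\<bar>x i\<bar> - B \<le> ?d i" if "i \<in> I" for i
    using B[of v] B[of "\<sigma> i"] v \<sigma> that by (auto simp: max_def)
  show "cross_energy (\<lambda>a b. \<bar>a - b\<bar>) I x J y \<ge> 0"
    using E sum_nonneg[of I ?d] d0 by simp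
  show "\<bar>x i\<bar> \<le> B + cross_energy (\<lambda>a b. \<bar>a - b\<bar>) I x J y" if "i \<in> I"
  proof -
    have "?d i \<le> sum ?d I" using d0 fin that by (intro member_le_sum) auto
    moreover have "0 \<le> sum ?d I" using d0 by (intro sum_nonneg)
    ultimately show ?thesis using E dB[OF that] by linarith
  qed
qed

section \<open>The logarithmic energy\<close>

definition log_dist :: "real \<Rightarrow> real \<Rightarrow> real" where
  "log_dist a b = ln (1 + \<bar>a - b\<bar>)"

lemma log_dist_nonneg: "0 \<le> log_dist a b"
  by (simp add: log_dist_def)

lemma log_dist_self [simp]: "log_dist a a = 0"
  by (simp add: log_dist_def)

lemma log_dist_commute: "log_dist a b = log_dist b a"
  by (simp add: log_dist_def abs_minus_commute)

lemma log_dist_triangle: "log_dist a c \<le> log_dist a b + log_dist b c"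
proof -
  have "1 + \<bar>a - c\<bar> \<le> (1 + \<bar>a - b\<bar>) + (1 + \<bar>b - c\<bar>) - 1" by simp
  also have "\<dots> \<le> (1 + \<bar>a - b\<bar>) * (1 + \<bar>b - c\<bar>)"
    by (simp add: algebra_simps)
  finally have "ln (1 + \<bar>a - c\<bar>) \<le> ln ((1 + \<bar>a - b\<bar>) * (1 + \<bar>b - c\<bar>))"
    by (subst ln_le_cancel_iff) (auto intro!: mult_pos_pos)
  also have "\<dots> = ln (1 + \<bar>a - b\<bar>) + ln (1 + \<bar>b - c\<bar>)"
    by (subst ln_mult) (auto simp: add_nonneg_eq_0_iff)
  finally show ?thesis by (simp add: log_dist_def)
qed

lemma log_dist_ultra: "log_dist a c \<le> max (log_dist a b) (log_dist b c) + ln 2"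
proof -
  have "\<bar>a - c\<bar> \<le> \<bar>a - b\<bar> + \<bar>b - c\<bar>" by arith
  moreover have "\<bar>a - b\<bar> \<le> max \<bar>a - b\<bar> \<bar>b - c\<bar>" "\<bar>b - c\<bar> \<le> max \<bar>a - b\<bar> \<bar>b - c\<bar>"
    by auto
  ultimately have "0 < 1 + \<bar>a - c\<bar>" "1 + \<bar>a - c\<bar> \<le> 2 * (1 + max \<bar>a - b\<bar> \<bar>b - c\<bar>)"
    by argo+
  then have "log_dist a c \<le> ln (2 * (1 + max \<bar>a - b\<bar> \<bar>b - c\<bar>))"
    unfolding log_dist_def by (subst ln_le_cancel_iff) linarith+
  also have "\<dots> = ln 2 + ln (1 + max \<bar>a - b\<bar> \<bar>b - c\<bar>)" by (subst ln_mult) auto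
  also have "ln (1 + max \<bar>a - b\<bar> \<bar>b - c\<bar>) = max (log_dist a b) (log_dist b c)"
    unfolding log_dist_def by (auto simp: max_def)
  finally show ?thesis by simp
qed

lemma pair_energy_nonneg:
  assumes "\<And>a b. 0 \<le> f a b"
  shows "0 \<le> pair_energy f I x"
  unfolding pair_energy_def by (intro sum_nonneg assms)

lemma log_dist_le_pair_energy:
  assumes "finite J" "i \<in> J" "j \<in> J"
  shows "log_dist (y i) (y j) \<le> pair_energy log_dist J y"
proof (cases "i = j")
  case True
  then show ?thesis by (simp add: pair_energy_nonneg log_dist_nonneg)
next
  case False
  have "log_dist (y i) (y j) \<le> (\<Sum>p\<in>J - {i}. log_dist (y i) (y p))"
    using assms False
    by (intro member_le_sum[of j "J - {i}" "\<lambda>p. log_dist (y i) (y p)"])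
       (auto simp: log_dist_nonneg)
  also have "\<dots> \<le> pair_energy log_dist J y"
    unfolding pair_energy_def using assms
    by (intro member_le_sum[of i J "\<lambda>s. \<Sum>p\<in>J - {s}. log_dist (y s) (y p)"])
       (auto simp: log_dist_nonneg sum_nonneg)
  finally show ?thesis .
qed

text \<open>
  One row of the elementary integrand. The matching bound yields factors
  \<open>(1 + \<bar>s - v\<bar>) / ((1 + \<bar>x - s\<bar>) * (1 + \<bar>x - v\<bar>))\<close>, whose integral over \<open>x\<close> grows like a logarithm of
  \<open>\<bar>s - v\<bar>\<close>. A small power \<open>b\<close> of the spread of the row \<open>y\<close> pays for this, and the rest decays like
  \<open>(1 + \<bar>x - s\<bar>) powr - (1 + b)\<close> in the distance to the nearer of the two points.
\<close>

lemma log_row_decay: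
  assumes fin: "finite I" "finite J" and card: "card J = Suc (card I)" and b: "0 \<le> b" "b \<le> 1"
  shows "\<exists>\<rho>. \<rho> ` I \<subseteq> J \<and> - cross_energy log_dist I x J y / 2
            \<le> ln 2 * ((real (card I))\<^sup>2 + real (card I))
                + b * real (card I) * pair_energy log_dist J y
                - (1 + b) * (\<Sum>i\<in>I. log_dist (x i) (y (\<rho> i)))"
proof -
  obtain \<sigma> v where v: "v \<in> J" and \<sigma>: "\<sigma> ` I \<subseteq> J" and
    le: "2 * (\<Sum>i\<in>I. log_dist (x i) (y (\<sigma> i)) + log_dist (x i) (y v)
                - log_dist (y (\<sigma> i)) (y v)) - 2 * ln 2 * (real (card I))\<^sup>2
          \<le> cross_energy log_dist I x J y"
    using ultrametric_matching[of log_dist "ln 2" I J x y, OF log_dist_commute log_dist_ultra _ fin card]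
    by auto
  define \<rho> where
    "\<rho> i = (if log_dist (x i) (y (\<sigma> i)) \<le> log_dist (x i) (y v) then \<sigma> i else v)" for i
  let ?P = "pair_energy log_dist J y"
  have "- (log_dist (x i) (y (\<sigma> i)) + log_dist (x i) (y v) - log_dist (y (\<sigma> i)) (y v))
        \<le> ln 2 + b * ?P - (1 + b) * log_dist (x i) (y (\<rho> i))" if i: "i \<in> I" for i
  proof -
    let ?s = "log_dist (x i) (y (\<sigma> i))" and ?v = "log_dist (x i) (y v)"
      and ?d = "log_dist (y (\<sigma> i)) (y v)"
    have "b * ?d \<le> b * ?P"
      using log_dist_le_pair_energy[OF fin(2), of "\<sigma> i" v y] \<sigma> v i b
      by (intro mult_left_mono) auto
    moreover have "(1 - b) * ?d \<le> (1 - b) * (max ?s ?v + ln 2)"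
      using log_dist_ultra[of "y (\<sigma> i)" "y v" "x i"] b
      by (intro mult_left_mono) (auto simp: log_dist_commute)
    moreover have "b * ln 2 \<ge> 0" using b by simp
    moreover have "b * min ?s ?v \<le> b * max ?s ?v" using b by (intro mult_left_mono) auto
    moreover have "log_dist (x i) (y (\<rho> i)) = min ?s ?v"
      by (auto simp: \<rho>_def)
    moreover have "?s + ?v = min ?s ?v + max ?s ?v" by auto
    ultimately show ?thesis by (simp only: algebra_simps)
  qed
  then have "(\<Sum>i\<in>I. - (log_dist (x i) (y (\<sigma> i)) + log_dist (x i) (y v)
                     - log_dist (y (\<sigma> i)) (y v)))
       \<le> (\<Sum>i\<in>I. ln 2 + b * ?P - (1 + b) * log_dist (x i) (y (\<rho> i)))"
    by (rule sum_mono)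
  also have "\<dots> = real (card I) * ln 2 + b * real (card I) * ?P
                - (1 + b) * (\<Sum>i\<in>I. log_dist (x i) (y (\<rho> i)))"
    by (simp add: sum_subtractf sum_distrib_left algebra_simps)
  finally have "- cross_energy log_dist I x J y / 2 \<le> ln 2 * ((real (card I))\<^sup>2 + real (card I))
                + b * real (card I) * ?P - (1 + b) * (\<Sum>i\<in>I. log_dist (x i) (y (\<rho> i)))"
    using le by (simp only: sum_negf algebra_simps)
  moreover have "\<rho> ` I \<subseteq> J" using \<sigma> v by (auto simp: \<rho>_def)
  ultimately show ?thesis by blast
qed

text \<open>
  The spread of a row is controlled by that of the next row and by the distances of its points
  to their parents.
\<close>

lemma log_pair_energy_transfer:
  assumes fin: "finite I" "finite J" and \<rho>: "\<rho> ` I \<subseteq> J"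
  shows "pair_energy log_dist I x \<le> 2 * real (card I) * (\<Sum>i\<in>I. log_dist (x i) (y (\<rho> i)))
            + (real (card I))\<^sup>2 * pair_energy log_dist J y"
proof -
  let ?u = "\<lambda>i. log_dist (x i) (y (\<rho> i))" and ?P = "pair_energy log_dist J y"
  have "pair_energy log_dist I x \<le> (\<Sum>i\<in>I. \<Sum>j\<in>I. log_dist (x i) (x j))"
    unfolding pair_energy_def
    by (intro sum_mono sum_mono2) (auto simp: fin log_dist_nonneg)
  also have "\<dots> \<le> (\<Sum>i\<in>I. \<Sum>j\<in>I. ?u i + ?P + ?u j)"
  proof (intro sum_mono)
    fix i j assume ij: "i \<in> I" "j \<in> I"
    have "log_dist (x i) (x j) \<le> ?u i + log_dist (y (\<rho> i)) (y (\<rho> j)) + log_dist (y (\<rho> j)) (x j)"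
      using log_dist_triangle[of "x i" "x j" "y (\<rho> i)"]
            log_dist_triangle[of "y (\<rho> i)" "x j" "y (\<rho> j)"] by linarith
    also have "log_dist (y (\<rho> i)) (y (\<rho> j)) \<le> ?P"
      using \<rho> ij fin by (intro log_dist_le_pair_energy) auto
    finally show "log_dist (x i) (x j) \<le> ?u i + ?P + ?u j" by (simp add: log_dist_commute)
  qed
  also have "\<dots> = 2 * real (card I) * (\<Sum>i\<in>I. ?u i) + (real (card I))\<^sup>2 * ?P"
    by (simp add: sum.distrib sum_distrib_left[symmetric] power2_eq_square algebra_simps)
  finally show ?thesis .
qed

definition row_energy :: "(real \<Rightarrow> real \<Rightarrow> real) \<Rightarrow> (nat \<Rightarrow> nat \<Rightarrow> real) \<Rightarrow> nat \<Rightarrow> real" where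
  "row_energy f X n = cross_energy f {1..n} (X n) {1..Suc n} (X (Suc n))"

text \<open>
  Induction over the rows: the power of the spread of row \<open>n\<close> which the rows below it have cost is
  absorbed partly by the decay available in row \<open>n\<close> and partly passed on to row \<open>n + 1\<close>. Each
  step enlarges that power by a factor depending on \<open>n\<close>, so the induction hypothesis is needed
  for every \<open>\<kappa>\<close>, and the decay rate \<open>\<beta>\<close> shrinks with \<open>\<kappa>\<close>. In the last row the
  points are fixed, and their spread is a constant.
\<close>

lemma log_energy_forest_bound:
  assumes "\<kappa> > 0"
  shows "\<exists>\<beta>>0. \<exists>C. \<forall>X. \<exists>\<rho>. (\<forall>m\<in>{1..N}. \<rho> m ` {1..m} \<subseteq> {1..Suc m}) \<and>
     - (\<Sum>m=1..N. row_energy log_dist X m) / 2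
       \<le> C + \<kappa> * pair_energy log_dist {1..Suc N} (X (Suc N))
          - (1 + \<beta>) * (\<Sum>m=1..N. \<Sum>k=1..m. log_dist (X m k) (X (Suc m) (\<rho> m k)))"
  using assms
proof (induction N arbitrary: \<kappa>)
  case 0
  show ?case
    using 0 by (intro exI[of _ 1] conjI exI[of _ 0])
      (auto intro!: mult_nonneg_nonneg pair_energy_nonneg log_dist_nonneg)
next
  case (Suc N)
  define n where "n = Suc N"
  \<comment> \<open>half of \<open>\<kappa>\<close> pays for the new row, the other half for the spread which is passed on;
    \<open>\<kappa>'\<close> is so small that absorbing it costs row \<open>n\<close> at most half of its decay\<close>
  define b where "b = min 1 (\<kappa> / (2 * real n))"
  define \<kappa>' where "\<kappa>' = min (\<kappa> / (2 * (real n)\<^sup>2)) (b / (4 * real n))"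
  have n: "real n > 0" by (simp add: n_def)
  have b: "0 < b" "b \<le> 1" "b * real n \<le> \<kappa> / 2"
    using n Suc.prems by (auto simp: b_def min_def field_simps)
  have \<kappa>': "\<kappa>' > 0" "\<kappa>' * (real n)\<^sup>2 \<le> \<kappa> / 2" "2 * real n * \<kappa>' \<le> b / 2"
    using n b Suc.prems by (auto simp: \<kappa>'_def min_def field_simps)
  obtain \<beta> C where \<beta>: "\<beta> > 0" and IH: "\<And>X. \<exists>\<rho>. (\<forall>m\<in>{1..N}. \<rho> m ` {1..m} \<subseteq> {1..Suc m}) \<and>
     - (\<Sum>m=1..N. row_energy log_dist X m) / 2
       \<le> C + \<kappa>' * pair_energy log_dist {1..Suc N} (X (Suc N))
          - (1 + \<beta>) * (\<Sum>m=1..N. \<Sum>k=1..m. log_dist (X m k) (X (Suc m) (\<rho> m k)))"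
    using Suc.IH[OF \<kappa>'(1)] by blast
  define C' where "C' = C + ln 2 * ((real n)\<^sup>2 + real n)"
  define \<gamma> where "\<gamma> = min \<beta> (b / 2)"
  have \<gamma>: "0 < \<gamma>" "\<gamma> \<le> \<beta>" "\<gamma> \<le> b / 2" using \<beta> b by (auto simp: \<gamma>_def)
  have "\<exists>\<rho>. (\<forall>m\<in>{1..n}. \<rho> m ` {1..m} \<subseteq> {1..Suc m}) \<and>
     - (\<Sum>m=1..n. row_energy log_dist X m) / 2
       \<le> C' + \<kappa> * pair_energy log_dist {1..Suc n} (X (Suc n))
          - (1 + \<gamma>) * (\<Sum>m=1..n. \<Sum>k=1..m. log_dist (X m k) (X (Suc m) (\<rho> m k)))" for X
  proof -
    obtain \<rho> where \<rho>: "\<forall>m\<in>{1..N}. \<rho> m ` {1..m} \<subseteq> {1..Suc m}" and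
      le: "- (\<Sum>m=1..N. row_energy log_dist X m) / 2
       \<le> C + \<kappa>' * pair_energy log_dist {1..n} (X n)
          - (1 + \<beta>) * (\<Sum>m=1..N. \<Sum>k=1..m. log_dist (X m k) (X (Suc m) (\<rho> m k)))"
      using IH[of X] unfolding n_def by blast
    obtain r where r: "r ` {1..n} \<subseteq> {1..Suc n}" and
      row: "- row_energy log_dist X n / 2 \<le> ln 2 * ((real n)\<^sup>2 + real n)
                + b * real n * pair_energy log_dist {1..Suc n} (X (Suc n))
                - (1 + b) * (\<Sum>i=1..n. log_dist (X n i) (X (Suc n) (r i)))"
      using log_row_decay[of "{1..n}" "{1..Suc n}" b "X n" "X (Suc n)"] b
      unfolding row_energy_def by auto
    define \<tau> where "\<tau> = \<rho>(n := r)"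
    define S where "S = (\<Sum>m=1..N. \<Sum>k=1..m. log_dist (X m k) (X (Suc m) (\<rho> m k)))"
    define R where "R = (\<Sum>i=1..n. log_dist (X n i) (X (Suc n) (r i)))"
    define P where "P = pair_energy log_dist {1..Suc n} (X (Suc n))"
    have nonneg: "0 \<le> S" "0 \<le> R" "0 \<le> P"
      unfolding S_def R_def P_def
      by (auto intro!: sum_nonneg log_dist_nonneg pair_energy_nonneg)
    have S': "(\<Sum>m=1..N. \<Sum>k=1..m. log_dist (X m k) (X (Suc m) (\<tau> m k))) = S"
      unfolding S_def by (intro sum.cong) (auto simp: \<tau>_def n_def)
    have sum: "(\<Sum>m=1..n. \<Sum>k=1..m. log_dist (X m k) (X (Suc m) (\<tau> m k))) = S + R"
    proof -
      define F where "F m = (\<Sum>k=1..m. log_dist (X m k) (X (Suc m) (\<tau> m k)))" for m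
      have "sum F {1..n} = sum F {1..N} + F n" by (simp add: n_def)
      moreover have "F n = R" by (simp add: F_def R_def \<tau>_def)
      moreover have "sum F {1..N} = S" using S' unfolding F_def .
      ultimately show ?thesis unfolding F_def by simp
    qed
    have "\<kappa>' * pair_energy log_dist {1..n} (X n) \<le> \<kappa>' * (2 * real n * R + (real n)\<^sup>2 * P)"
      using log_pair_energy_transfer[of "{1..n}" "{1..Suc n}" r "X n" "X (Suc n)"] r \<kappa>'
      by (intro mult_left_mono) (auto simp: R_def P_def)
    also have "\<dots> \<le> b / 2 * R + \<kappa> / 2 * P"
      using mult_right_mono[OF \<kappa>'(3) nonneg(2)] mult_right_mono[OF \<kappa>'(2) nonneg(3)]
      by (simp add: algebra_simps)
    finally have 1: "\<kappa>' * pair_energy log_dist {1..n} (X n) \<le> b / 2 * R + \<kappa> / 2 * P" .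
    have 2: "b * real n * P \<le> \<kappa> / 2 * P"
      using mult_right_mono[OF b(3) nonneg(3)] by simp
    have 3: "\<gamma> * S \<le> \<beta> * S" "\<gamma> * R \<le> b / 2 * R"
      by (rule mult_right_mono[OF \<gamma>(2) nonneg(1)], rule mult_right_mono[OF \<gamma>(3) nonneg(2)])
    have "- (\<Sum>m=1..n. row_energy log_dist X m) / 2
        = - (\<Sum>m=1..N. row_energy log_dist X m) / 2 - row_energy log_dist X n / 2"
      by (simp add: n_def)
    also have "\<dots> \<le> C' + \<kappa> * P - (1 + \<gamma>) * (S + R)"
      using le row 1 2 3 unfolding C'_def S_def[symmetric] R_def[symmetric] P_def[symmetric]
      by (simp add: algebra_simps)
    finally have "- (\<Sum>m=1..n. row_energy log_dist X m) / 2 \<le> C' + \<kappa> * P - (1 + \<gamma>) * (S + R)" .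
    moreover have "\<forall>m\<in>{1..n}. \<tau> m ` {1..m} \<subseteq> {1..Suc m}"
    proof
      fix m assume m: "m \<in> {1..n}"
      show "\<tau> m ` {1..m} \<subseteq> {1..Suc m}"
      proof (cases "m = n")
        case True
        then show ?thesis using r by (simp add: \<tau>_def)
      next
        case False
        then have "m \<in> {1..N}" using m by (auto simp: n_def)
        then have "\<rho> m ` {1..m} \<subseteq> {1..Suc m}" using \<rho> by blast
        then show ?thesis using False by (simp add: \<tau>_def)
      qed
    qed
    ultimately show ?thesis unfolding P_def sum[symmetric] by blast
  qed
  then show ?case unfolding n_def using \<gamma>(1) by blast
qed

text \<open>
  In the integrands the interaction within a row counts twice, once for each neighbouring row.
  Summing over all rows leaves only the boundary term of the top row, because row 1 has a single
  point.
\<close>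

lemma row_energy_telescope:
  "(\<Sum>n=1..N. 2 * ((\<Sum>k=1..n. \<Sum>m=1..Suc n. f (X n k) (X (Suc n) m)) - pair_energy f {1..n} (X n)))
     = (\<Sum>n=1..N. row_energy f X n) + pair_energy f {1..Suc N} (X (Suc N))"
proof (induction N)
  case 0
  then show ?case by (simp add: pair_energy_def)
next
  case (Suc N)
  define F where
    "F n = 2 * ((\<Sum>k=1..n. \<Sum>m=1..Suc n. f (X n k) (X (Suc n) m)) - pair_energy f {1..n} (X n))" for n
  have "F n = row_energy f X n + pair_energy f {1..Suc n} (X (Suc n)) - pair_energy f {1..n} (X n)" for n
    unfolding F_def row_energy_def cross_energy_def by (simp only: algebra_simps)
  then have "sum F {1..Suc N} = sum F {1..N} + row_energy f X (Suc N)
      + pair_energy f {1..Suc (Suc N)} (X (Suc (Suc N))) - pair_energy f {1..Suc N} (X (Suc N))"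
    by simp
  moreover have "sum F {1..N} = (\<Sum>n=1..N. row_energy f X n) + pair_energy f {1..Suc N} (X (Suc N))"
    using Suc.IH unfolding F_def .
  moreover have "(\<Sum>n=1..Suc N. row_energy f X n) = (\<Sum>n=1..N. row_energy f X n) + row_energy f X (Suc N)"
    by simp
  ultimately have "sum F {1..Suc N}
      = (\<Sum>n=1..Suc N. row_energy f X n) + pair_energy f {1..Suc (Suc N)} (X (Suc (Suc N)))"
    by linarith
  then show ?case unfolding F_def .
qed

lemma pair_energy_distinct_pairs:
  "pair_energy f {1..n} x = (\<Sum>(s, p)\<in>distinct_pairs n. f (x s) (x p))"
proof -
  have "distinct_pairs n = (SIGMA s:{1..n}. {1..n} - {s})"
    by (auto simp: distinct_pairs_def)
  then show ?thesis by (simp add: pair_energy_def sum.Sigma)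
qed

section \<open>Integrability along a forest\<close>

lemma nn_integral_powr_decay_finite:
  fixes e :: real
  assumes "e < -1"
  shows "(\<integral>\<^sup>+u. ennreal ((1 + \<bar>u\<bar>) powr e) \<partial>lborel) < \<infinity>"
proof -
  let ?g = "\<lambda>u::real. ennreal (indicator {1..} u * u powr e)"
  have fin: "(\<integral>\<^sup>+u. ?g u \<partial>lborel) < \<infinity>"
    using nn_integral_has_integral_lebesgue[OF _ has_integral_powr_to_inf[OF assms, of 1]]
    by (simp add: less_top[symmetric])
  have shift: "(\<integral>\<^sup>+u. ?g (1 + c * u) \<partial>lborel) = (\<integral>\<^sup>+u. ?g u \<partial>lborel)" if "\<bar>c\<bar> = 1" for c
    using nn_integral_real_affine[of ?g c 1] that by auto
  have "(\<integral>\<^sup>+u. ennreal ((1 + \<bar>u\<bar>) powr e) \<partial>lborel)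
      \<le> (\<integral>\<^sup>+u. ?g (1 + 1 * u) + ?g (1 + (-1) * u) \<partial>lborel)"
  proof (rule nn_integral_mono)
    fix u :: real
    show "ennreal ((1 + \<bar>u\<bar>) powr e) \<le> ?g (1 + 1 * u) + ?g (1 + (-1) * u)"
      by (cases "0 \<le> u") (auto simp: indicator_def)
  qed
  also have "\<dots> = (\<integral>\<^sup>+u. ?g (1 + 1 * u) \<partial>lborel) + (\<integral>\<^sup>+u. ?g (1 + (-1) * u) \<partial>lborel)"
    by (rule nn_integral_add) measurable
  also have "\<dots> < \<infinity>"
    unfolding shift[of 1, simplified abs_one, OF refl] using shift[of "-1"] fin
    by (simp add: ennreal_add_less_top)
  finally show ?thesis .
qed

text \<open>
  Coordinates outside the index set are the constant \<open>undefined\<close>, hence measurable. This spares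
  the induction over index sets below any condition on parents.
\<close>

lemma borel_measurable_PiM_coordinate:
  "(\<lambda>t. t w) \<in> borel_measurable (Pi\<^sub>M S (\<lambda>_. lborel :: real measure))"
proof (cases "w \<in> S")
  case True
  then show ?thesis by measurable
next
  case False
  then have "(\<lambda>t. t w) \<in> borel_measurable (Pi\<^sub>M S (\<lambda>_. lborel :: real measure))
      \<longleftrightarrow> (\<lambda>t. undefined :: real) \<in> borel_measurable (Pi\<^sub>M S (\<lambda>_. lborel :: real measure))"
    by (intro measurable_cong) (auto simp: space_PiM PiE_def extensional_def)
  then show ?thesis by simp
qed

text \<open>
  Integrate the coordinates in order of decreasing rank: the current one occurs in a single
  factor, and by translation invariance its integral does not depend on its parent.
\<close>

lemma nn_integral_forest:
  fixes h :: "real \<Rightarrow> ennreal" and q :: "'i \<Rightarrow> ('i \<Rightarrow> real) \<Rightarrow> real" and rank :: "'i \<Rightarrow> nat"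
  assumes [measurable]: "h \<in> borel_measurable borel" and "finite S"
    and q: "\<And>v. (\<exists>c. q v = (\<lambda>_. c)) \<or> (\<exists>w. rank w < rank v \<and> q v = (\<lambda>t. t w))"
  shows "(\<integral>\<^sup>+t. (\<Prod>v\<in>S. h (t v - q v t)) \<partial>Pi\<^sub>M S (\<lambda>_. lborel))
           = (\<integral>\<^sup>+u. h u \<partial>lborel) ^ card S"
  using \<open>finite S\<close>
proof (induction S rule: finite_ranking_induct[where f = rank])
  case empty
  then show ?case by (simp add: nn_integral_count_space_finite PiM_empty)
next
  case (insert v S)
  show ?case
  proof (cases "v \<in> S")
    case True
    then show ?thesis using insert.IH by (simp add: insert_absorb)
  next
    case False
    interpret product_sigma_finite "\<lambda>_::'i. lborel :: real measure"
      by (rule product_sigma_finite.intro) (rule lborel.sigma_finite_measure_axioms)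
    have q_meas[measurable]: "q w \<in> borel_measurable (Pi\<^sub>M T (\<lambda>_. lborel))" for w T
      using q[of w] borel_measurable_PiM_coordinate by auto
    have coord[measurable]: "(\<lambda>t. t w) \<in> borel_measurable (Pi\<^sub>M T (\<lambda>_. lborel :: real measure))" for w T
      by (rule borel_measurable_PiM_coordinate)
    have q_upd: "q w (t(v := y)) = q w t" if "rank w \<le> rank v" for w t y
      using q[of w] that by auto
    have meas: "(\<lambda>t. \<Prod>w\<in>insert v S. h (t w - q w t))
        \<in> borel_measurable (Pi\<^sub>M (insert v S) (\<lambda>_. lborel))"
      by measurable
    have "(\<integral>\<^sup>+t. (\<Prod>w\<in>insert v S. h (t w - q w t)) \<partial>Pi\<^sub>M (insert v S) (\<lambda>_. lborel))
        = (\<integral>\<^sup>+t. (\<integral>\<^sup>+y. (\<Prod>w\<in>insert v S. h ((t(v := y)) w - q w (t(v := y)))) \<partial>lborel)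
             \<partial>Pi\<^sub>M S (\<lambda>_. lborel))"
      by (rule product_nn_integral_insert[OF insert.hyps(1) False meas])
    also have "\<dots> = (\<integral>\<^sup>+t. (\<integral>\<^sup>+u. h u \<partial>lborel) * (\<Prod>w\<in>S. h (t w - q w t)) \<partial>Pi\<^sub>M S (\<lambda>_. lborel))"
    proof (rule nn_integral_cong)
      fix t :: "'i \<Rightarrow> real"
      have "(\<Prod>w\<in>insert v S. h ((t(v := y)) w - q w (t(v := y))))
          = h (y - q v t) * (\<Prod>w\<in>S. h (t w - q w t))" for y
      proof -
        have "(\<Prod>w\<in>S. h ((t(v := y)) w - q w (t(v := y)))) = (\<Prod>w\<in>S. h (t w - q w t))"
          using False insert.hyps(2) by (intro prod.cong refl) (auto simp: q_upd)
        then show ?thesis using False insert.hyps(1) by (simp add: q_upd)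
      qed
      then have "(\<integral>\<^sup>+y. (\<Prod>w\<in>insert v S. h ((t(v := y)) w - q w (t(v := y)))) \<partial>lborel)
          = (\<integral>\<^sup>+y. h (y - q v t) \<partial>lborel) * (\<Prod>w\<in>S. h (t w - q w t))"
        by (simp add: nn_integral_multc)
      also have "(\<integral>\<^sup>+y. h (y - q v t) \<partial>lborel) = (\<integral>\<^sup>+u. h u \<partial>lborel)"
        using nn_integral_real_affine[of h 1 "- q v t"] by (simp add: add.commute[of "- q v t"])
      finally show "(\<integral>\<^sup>+y. (\<Prod>w\<in>insert v S. h ((t(v := y)) w - q w (t(v := y)))) \<partial>lborel)
          = (\<integral>\<^sup>+u. h u \<partial>lborel) * (\<Prod>w\<in>S. h (t w - q w t))" .
    qed
    also have "\<dots> = (\<integral>\<^sup>+u. h u \<partial>lborel) * (\<integral>\<^sup>+u. h u \<partial>lborel) ^ card S"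
      by (subst nn_integral_cmult) (measurable, simp add: insert.IH)
    finally show ?thesis using False insert.hyps(1) by simp
  qed
qed

definition re_gam :: "nat \<Rightarrow> (nat \<Rightarrow> real) \<Rightarrow> (nat \<times> nat \<Rightarrow> real) \<Rightarrow> nat \<Rightarrow> nat \<Rightarrow> real" where
  "re_gam l lam t n j = (if n = l + 1 then lam j else t (n, j))"

lemma finite_triangle: "finite (triangle l)"
  by (simp add: triangle_def)

lemma borel_measurable_re_gam [measurable]:
  "(\<lambda>t. re_gam l lam t n j) \<in> borel_measurable (Pi\<^sub>M S (\<lambda>_. lborel))"
  using borel_measurable_PiM_coordinate[of "(n, j)" S] by (cases "n = l + 1") (auto simp: re_gam_def)

lemma integrable_forest:
  assumes "\<beta> > 0"
  shows "integrable (Pi\<^sub>M (triangle l) (\<lambda>_. lborel))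
    (\<lambda>t. \<Prod>v\<in>triangle l.
       (1 + \<bar>re_gam l lam t (fst v) (snd v) - re_gam l lam t (Suc (fst v)) (\<rho> v)\<bar>) powr - (1 + \<beta>))"
proof (rule integrableI_bounded)
  let ?M = "Pi\<^sub>M (triangle l) (\<lambda>_. lborel :: real measure)"
  let ?h = "\<lambda>u::real. ennreal ((1 + \<bar>u\<bar>) powr - (1 + \<beta>))"
  let ?f = "\<lambda>t. \<Prod>v\<in>triangle l.
       (1 + \<bar>re_gam l lam t (fst v) (snd v) - re_gam l lam t (Suc (fst v)) (\<rho> v)\<bar>) powr - (1 + \<beta>)"
  let ?q = "\<lambda>v t. if fst v < l then t (Suc (fst v), \<rho> v) else lam (\<rho> v)"
  show "?f \<in> borel_measurable ?M" by measurable
  have "(\<integral>\<^sup>+t. ennreal (norm (?f t)) \<partial>?M) = (\<integral>\<^sup>+t. (\<Prod>v\<in>triangle l. ?h (t v - ?q v t)) \<partial>?M)"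
  proof (rule nn_integral_cong)
    fix t :: "nat \<times> nat \<Rightarrow> real"
    have "ennreal (norm (?f t)) = (\<Prod>v\<in>triangle l. ennreal
       ((1 + \<bar>re_gam l lam t (fst v) (snd v) - re_gam l lam t (Suc (fst v)) (\<rho> v)\<bar>) powr - (1 + \<beta>)))"
      by (simp add: prod_ennreal abs_prod)
    also have "\<dots> = (\<Prod>v\<in>triangle l. ?h (t v - ?q v t))"
      by (intro prod.cong refl) (auto simp: triangle_def re_gam_def)
    finally show "ennreal (norm (?f t)) = (\<Prod>v\<in>triangle l. ?h (t v - ?q v t))" .
  qed
  also have "\<dots> = (\<integral>\<^sup>+u. ?h u \<partial>lborel) ^ card (triangle l)"
  proof (rule nn_integral_forest[where rank = "\<lambda>v. l - fst v"])
    fix v :: "nat \<times> nat"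
    show "(\<exists>c. ?q v = (\<lambda>_. c)) \<or> (\<exists>w. l - fst w < l - fst v \<and> ?q v = (\<lambda>t. t w))"
    proof (cases "fst v < l")
      case True
      then show ?thesis by (intro disjI2 exI[of _ "(Suc (fst v), \<rho> v)"]) auto
    qed auto
  qed (auto simp: finite_triangle)
  also have "\<dots> < \<infinity>"
    using nn_integral_powr_decay_finite[of "- (1 + \<beta>)"] assms by (simp add: power_less_top_ennreal)
  finally show "(\<integral>\<^sup>+t. ennreal (norm (?f t)) \<partial>?M) < \<infinity>" .
qed

lemma finite_distinct_pairs: "finite (distinct_pairs n)"
  by (rule finite_subset[of _ "{1..n} \<times> {1..n}"]) (auto simp: distinct_pairs_def)

section \<open>Majorant of the elementary integrand\<close>

text \<open>
  The parent function \<open>\<rho>\<close> found for a given array depends on the array; summing over the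
  finitely many candidates gives a bound by one integrable function.
\<close>

lemma elementary_weight_bound:
  "\<exists>\<beta>>0. \<exists>C>0. \<forall>t.
     (\<Prod>n=1..l. (\<Prod>(s, p)\<in>distinct_pairs n. 1 + \<bar>re_gam l lam t n s - re_gam l lam t n p\<bar>)
               / (\<Prod>k=1..n. \<Prod>m=1..Suc n. 1 + \<bar>re_gam l lam t n k - re_gam l lam t (Suc n) m\<bar>))
     \<le> C * (\<Sum>\<rho>\<in>Pi\<^sub>E (triangle l) (\<lambda>v. {1..Suc (fst v)}). \<Prod>v\<in>triangle l.
       (1 + \<bar>re_gam l lam t (fst v) (snd v) - re_gam l lam t (Suc (fst v)) (\<rho> v)\<bar>) powr - (1 + \<beta>))"
proof -
  obtain \<beta> C where \<beta>: "\<beta> > 0" and bound: "\<forall>X. \<exists>\<rho>. (\<forall>m\<in>{1..l}. \<rho> m ` {1..m} \<subseteq> {1..Suc m}) \<and>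
     - (\<Sum>m=1..l. row_energy log_dist X m) / 2
       \<le> C + 1 * pair_energy log_dist {1..Suc l} (X (Suc l))
          - (1 + \<beta>) * (\<Sum>m=1..l. \<Sum>k=1..m. log_dist (X m k) (X (Suc m) (\<rho> m k)))"
    using log_energy_forest_bound[OF zero_less_one, of l]
    by (elim exE conjE) (rule that, assumption+)
  define D where "D = exp (C + pair_energy log_dist {1..Suc l} lam)"
  have exp_log_dist: "exp (log_dist a b) = 1 + \<bar>a - b\<bar>" for a b
    by (simp add: log_dist_def add_pos_nonneg)
  have "(\<Prod>n=1..l. (\<Prod>(s, p)\<in>distinct_pairs n. 1 + \<bar>re_gam l lam t n s - re_gam l lam t n p\<bar>)
               / (\<Prod>k=1..n. \<Prod>m=1..Suc n. 1 + \<bar>re_gam l lam t n k - re_gam l lam t (Suc n) m\<bar>))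
     \<le> D * (\<Sum>\<rho>\<in>Pi\<^sub>E (triangle l) (\<lambda>v. {1..Suc (fst v)}). \<Prod>v\<in>triangle l.
       (1 + \<bar>re_gam l lam t (fst v) (snd v) - re_gam l lam t (Suc (fst v)) (\<rho> v)\<bar>) powr - (1 + \<beta>))"
    (is "?W \<le> D * sum ?F ?R") for t
  proof -
    let ?X = "re_gam l lam t"
    obtain \<rho> where \<rho>: "\<forall>m\<in>{1..l}. \<rho> m ` {1..m} \<subseteq> {1..Suc m}" and
      le: "- (\<Sum>m=1..l. row_energy log_dist ?X m) / 2
       \<le> C + 1 * pair_energy log_dist {1..Suc l} (?X (Suc l))
          - (1 + \<beta>) * (\<Sum>m=1..l. \<Sum>k=1..m. log_dist (?X m k) (?X (Suc m) (\<rho> m k)))"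
      using bound[rule_format, of ?X] by (elim exE conjE) (rule that, assumption+)
    have last: "pair_energy log_dist {1..Suc l} (?X (Suc l)) = pair_energy log_dist {1..Suc l} lam"
      by (simp add: re_gam_def[abs_def])
    define r where "r = restrict (\<lambda>v. \<rho> (fst v) (snd v)) (triangle l)"
    have r_in: "\<rho> m k \<in> {1..Suc m}" if "(m, k) \<in> triangle l" for m k
    proof -
      have "m \<in> {1..l}" "k \<in> {1..m}" using that by (auto simp: triangle_def)
      then show ?thesis using \<rho> by blast
    qed
    have r: "r \<in> ?R"
    proof (rule PiE_I)
      fix v assume "v \<in> triangle l"
      then show "r v \<in> {1..Suc (fst v)}" using r_in[of "fst v" "snd v"] by (simp add: r_def)
    qed (simp add: r_def)
    have "(\<Sum>m=1..l. \<Sum>k=1..m. log_dist (?X m k) (?X (Suc m) (\<rho> m k)))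
        = (\<Sum>v\<in>triangle l. log_dist (?X (fst v) (snd v)) (?X (Suc (fst v)) (r v)))"
      unfolding triangle_def
      by (subst sum.Sigma) (simp, simp, intro sum.cong refl, auto simp: r_def triangle_def)
    note le = le[unfolded this]
    define A where "A n = pair_energy log_dist {1..n} (?X n)" for n
    define B where "B n = (\<Sum>k=1..n. \<Sum>m=1..Suc n. log_dist (?X n k) (?X (Suc n) m))" for n
    define G where "G = (\<Sum>v\<in>triangle l. log_dist (?X (fst v) (snd v)) (?X (Suc (fst v)) (r v)))"
    have num: "(\<Prod>(s, p)\<in>distinct_pairs n. 1 + \<bar>?X n s - ?X n p\<bar>) = exp (A n)" for n
      unfolding A_def pair_energy_distinct_pairs
      by (simp add: exp_sum finite_distinct_pairs case_prod_beta exp_log_dist)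
    have den: "(\<Prod>k=1..n. \<Prod>m=1..Suc n. 1 + \<bar>?X n k - ?X (Suc n) m\<bar>) = exp (B n)" for n
      unfolding B_def by (simp only: exp_sum finite_atLeastAtMost exp_log_dist)
    have tele: "(\<Sum>n=1..l. 2 * (B n - A n))
        = (\<Sum>n=1..l. row_energy log_dist ?X n) + pair_energy log_dist {1..Suc l} lam"
      unfolding A_def B_def last[symmetric] by (rule row_energy_telescope)
    have "(\<Sum>n=1..l. 2 * (B n - A n)) = - 2 * (\<Sum>n=1..l. A n - B n)"
      by (simp add: sum_distrib_left[symmetric] sum_subtractf)
    moreover have "0 \<le> pair_energy log_dist {1..Suc l} lam"
      by (rule pair_energy_nonneg[OF log_dist_nonneg])
    ultimately have expo: "(\<Sum>n=1..l. A n - B n)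
        \<le> C + pair_energy log_dist {1..Suc l} lam - (1 + \<beta>) * G"
      using le tele unfolding last G_def[symmetric] by linarith
    have "?W = exp (\<Sum>n=1..l. A n - B n)"
      unfolding num den exp_diff[symmetric] by (simp only: exp_sum finite_atLeastAtMost)
    also have "\<dots> \<le> exp (C + pair_energy log_dist {1..Suc l} lam - (1 + \<beta>) * G)"
      using expo by simp
    also have "\<dots> = D * exp (\<Sum>v\<in>triangle l. - (1 + \<beta>) *
        log_dist (?X (fst v) (snd v)) (?X (Suc (fst v)) (r v)))"
      unfolding sum_distrib_left[symmetric] G_def[symmetric] D_def exp_add[symmetric]
      by (simp add: algebra_simps)
    also have "exp (\<Sum>v\<in>triangle l. - (1 + \<beta>) *
        log_dist (?X (fst v) (snd v)) (?X (Suc (fst v)) (r v))) = ?F r"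
      unfolding exp_sum[OF finite_triangle]
      by (intro prod.cong refl) (simp add: powr_def log_dist_def add_nonneg_eq_0_iff)
    also have "?F r \<le> sum ?F ?R"
      using r by (intro member_le_sum) (auto intro!: prod_nonneg finite_PiE simp: finite_triangle)
    finally show ?thesis by (simp add: D_def)
  qed
  moreover have "D > 0" by (simp add: D_def)
  ultimately show ?thesis using \<beta> by blast
qed

section \<open>The Gamma function on a vertical strip\<close>

text \<open>
  For fixed imaginary part, \<open>norm (Gamma (s + i y)) / Gamma s\<close> is increasing in \<open>s\<close>: it is the limit of
  products of the factors \<open>(s + k) / norm (s + k + i y)\<close>, each of which is increasing. Thus one
  vertical line controls a whole strip.
\<close>

lemma norm_rGamma_ratio_mono:
  fixes s s' y :: real
  assumes "0 < s" "s \<le> s'"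
  shows "norm (rGamma (Complex s' y)) * rGamma s \<le> norm (rGamma (Complex s y)) * rGamma s'"
proof (rule LIMSEQ_le)
  let ?z = "Complex s y" and ?z' = "Complex s' y"
  show "(\<lambda>n. norm (rGamma_series ?z' n) * rGamma_series s n) \<longlonglongrightarrow> norm (rGamma ?z') * rGamma s"
       "(\<lambda>n. norm (rGamma_series ?z n) * rGamma_series s' n) \<longlonglongrightarrow> norm (rGamma ?z) * rGamma s'"
    by (intro tendsto_intros)+
  have factor: "norm (?z' + of_nat k) * (s + real k) \<le> norm (?z + of_nat k) * (s' + real k)" for k
  proof -
    have pos: "0 < s + real k" "0 < s' + real k" "s + real k \<le> s' + real k" using assms by auto
    have "((s' + real k)\<^sup>2 + y\<^sup>2) * (s + real k)\<^sup>2 \<le> ((s + real k)\<^sup>2 + y\<^sup>2) * (s' + real k)\<^sup>2"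
      using mult_left_mono[OF power_mono[OF pos(3), of 2], of "y\<^sup>2"] pos by (simp add: algebra_simps)
    then have "sqrt (((s' + real k)\<^sup>2 + y\<^sup>2) * (s + real k)\<^sup>2)
        \<le> sqrt (((s + real k)\<^sup>2 + y\<^sup>2) * (s' + real k)\<^sup>2)" by simp
    then show ?thesis using pos by (simp add: cmod_def real_sqrt_mult)
  qed
  have "norm (rGamma_series ?z' n) * rGamma_series s n \<le> norm (rGamma_series ?z n) * rGamma_series s' n" for n
  proof -
    have "(\<Prod>k=0..n. norm (?z' + of_nat k) * (s + real k)) \<le> (\<Prod>k=0..n. norm (?z + of_nat k) * (s' + real k))"
      using factor assms by (intro prod_mono) auto
    then have "norm (pochhammer ?z' (n+1)) * pochhammer s (n+1) \<le> norm (pochhammer ?z (n+1)) * pochhammer s' (n+1)"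
      by (simp add: pochhammer_prod prod_norm[symmetric] prod.distrib atLeast0LessThan[symmetric] atLeastLessThanSuc_atLeastAtMost)
    moreover have "norm (exp (w * of_real (ln (of_nat n)))) = exp (Re w * ln (real n))" for w :: complex
      by simp
    ultimately show ?thesis
      by (simp add: rGamma_series_def norm_divide norm_mult field_simps)
  qed
  then show "\<exists>N. \<forall>n\<ge>N. norm (rGamma_series ?z' n) * rGamma_series s n
       \<le> norm (rGamma_series ?z n) * rGamma_series s' n" by blast
qed

lemma norm_sin_le: "norm (sin z) \<le> norm z * exp \<bar>Im z\<bar>" for z :: complex
proof -
  have cos: "norm (cos w) \<le> exp \<bar>Im z\<bar>" if w: "w \<in> closed_segment 0 z" for w
  proof -
    obtain u where u: "0 \<le> u" "u \<le> 1" "w = u *\<^sub>R z" using w by (auto simp: in_segment)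
    have "\<bar>Im w\<bar> \<le> \<bar>Im z\<bar>" using u by (simp add: abs_mult mult_left_le_one_le)
    have "norm (cos w) \<le> (norm (exp (\<i> * w)) + norm (exp (- (\<i> * w)))) / 2"
      using norm_triangle_ineq[of "exp (\<i> * w)" "exp (- (\<i> * w))"]
      unfolding cos_exp_eq by (simp add: norm_divide)
    also have "\<dots> \<le> (exp \<bar>Im w\<bar> + exp \<bar>Im w\<bar>) / 2" by (intro divide_right_mono add_mono) auto
    also have "\<dots> \<le> exp \<bar>Im z\<bar>" using \<open>\<bar>Im w\<bar> \<le> \<bar>Im z\<bar>\<close> by simp
    finally show ?thesis .
  qed
  have "norm (sin z - sin 0) \<le> exp \<bar>Im z\<bar> * norm (z - 0)"
    by (rule field_differentiable_bound[where S = "closed_segment 0 z" and f' = cos])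
       (auto intro!: derivative_eq_intros cos)
  then show ?thesis by (simp add: mult.commute)
qed

text \<open>
  The factors of the denominator come in pairs of opposite arguments, whose product is a sine by
  the reflection formula.
\<close>

lemma norm_rGamma_pair_le:
  "norm (rGamma w) * norm (rGamma (- w)) \<le> (norm w)\<^sup>2 * exp (pi * \<bar>Im w\<bar>)" for w :: complex
proof -
  have "norm (rGamma w) * norm (rGamma (- w)) = norm w * norm (sin (of_real pi * w)) / pi"
    by (simp add: norm_mult[symmetric] rGamma_reflection_complex' norm_divide)
  also have "\<dots> \<le> norm w * (norm (of_real pi * w) * exp \<bar>Im (of_real pi * w)\<bar>) / pi"
    by (intro divide_right_mono mult_left_mono norm_sin_le) auto
  also have "\<dots> = (norm w)\<^sup>2 * exp (pi * \<bar>Im w\<bar>)"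
    by (simp add: norm_mult abs_mult power2_eq_square)
  finally show ?thesis .
qed

text \<open>
  On this line the modulus is elementary: for \<open>y \<noteq> 0\<close> the reflection formula and conjugation give
  \<open>(norm (Gamma (i y)))\<^sup>2 = pi / (y * sinh (pi * y))\<close>, and the functional equation leads from there
  to real part 2.
\<close>

lemma norm_Gamma_two_le:
  "norm (Gamma (Complex 2 y)) \<le> 3 * (1 + \<bar>y\<bar>)\<^sup>2 * exp (- (pi * \<bar>y\<bar> / 2))"
proof (cases "y = 0")
  case True
  have "Complex 2 0 = of_nat 2" by (simp add: complex_eq_iff)
  then show ?thesis using True Gamma_fact[of 1, where 'a=complex] by simp
next
  case False
  define z where "z = Complex 0 y"
  define u where "u = pi * \<bar>y\<bar>"
  have u: "u > 0" using False by (simp add: u_def)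
  have z: "z \<noteq> 0" "norm z = \<bar>y\<bar>" "- z = cnj z" "1 + z \<noteq> 0"
    using False by (auto simp: z_def complex_eq_iff cmod_def)
  have norm_sin: "norm (sin (of_real pi * z)) = sinh u"
  proof -
    have "of_real pi * z = \<i> * of_real (pi * y)" by (simp add: z_def complex_eq_iff)
    moreover have "\<i> * (\<i> * of_real (pi * y)) = of_real (- (pi * y))"
      by (simp add: mult.assoc[symmetric])
    moreover have "sinh (of_real r :: complex) = of_real (sinh r)" for r :: real
      by (simp add: sinh_field_def exp_of_real exp_of_real[of "- r", simplified])
    ultimately have "norm (sin (of_real pi * z)) = \<bar>sinh (- (pi * y))\<bar>"
      by (simp only: sin_conv_sinh norm_mult norm_minus_cancel norm_ii norm_of_real)
    also have "\<dots> = sinh u"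
      by (cases "y \<ge> 0") (auto simp: u_def abs_if zero_less_mult_iff)
    finally show ?thesis .
  qed
  have sq: "(norm (Gamma z))\<^sup>2 = pi / (\<bar>y\<bar> * sinh u)"
  proof -
    have "(norm (Gamma z))\<^sup>2 = norm (Gamma z * Gamma (- z))"
      unfolding z(3) cnj_Gamma[symmetric] by (simp add: norm_mult power2_eq_square)
    also have "\<dots> = pi / (\<bar>y\<bar> * sinh u)"
      unfolding Gamma_reflection_complex' by (simp add: norm_divide norm_mult norm_sin z(2))
    finally show ?thesis .
  qed
  have two: "Complex 2 y = z + 1 + 1" by (simp add: z_def complex_eq_iff)
  have "(norm (Gamma (Complex 2 y)))\<^sup>2 = (norm (1 + z))\<^sup>2 * (\<bar>y\<bar>\<^sup>2 * (norm (Gamma z))\<^sup>2)"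
  proof -
    have "z \<notin> \<int>\<^sub>\<le>\<^sub>0" "z + 1 \<notin> \<int>\<^sub>\<le>\<^sub>0"
      using False by (auto elim!: nonpos_Ints_cases simp: z_def complex_eq_iff)
    then have "Gamma (Complex 2 y) = (z + 1) * (z * Gamma z)"
      unfolding two using Gamma_plus1[of z] Gamma_plus1[of "z + 1"] by simp
    then show ?thesis by (simp add: norm_mult z(2) power_mult_distrib add.commute)
  qed
  also have "\<dots> = (1 + y\<^sup>2) * (u / sinh u)"
  proof -
    have "(norm (1 + z))\<^sup>2 = 1 + y\<^sup>2" by (simp add: z_def cmod_def)
    moreover have "\<bar>y\<bar>\<^sup>2 * (pi / (\<bar>y\<bar> * sinh u)) = u / sinh u"
      using False unfolding u_def power2_eq_square by (simp add: divide_simps)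
    ultimately show ?thesis unfolding sq by simp
  qed
  also have "\<dots> \<le> (1 + y\<^sup>2) * ((1 + 2 * u) * exp (- u))"
  proof (intro mult_left_mono)
    have "(1 + 2 * u) * exp (- (2 * u)) \<le> 1"
      using exp_ge_add_one_self[of "2 * u"] by (simp add: exp_minus field_simps)
    then have "2 * u \<le> (1 + 2 * u) * (1 - exp (- (2 * u)))" by (simp add: algebra_simps)
    also have "\<dots> = (1 + 2 * u) * exp (- u) * (2 * sinh u)"
    proof -
      have "exp (- u) * (2 * sinh u) = 1 - exp (- (2 * u))"
      proof -
        have "2 * sinh u = exp u - exp (- u)" by (simp add: sinh_field_def)
        then show ?thesis by (simp add: right_diff_distrib mult_exp_exp)
      qed
      then show ?thesis by (simp only: mult.assoc)
    qed
    finally have "u \<le> (1 + 2 * u) * exp (- u) * sinh u" by simp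
    then show "u / sinh u \<le> (1 + 2 * u) * exp (- u)" using u by (simp add: pos_divide_le_eq)
  qed simp
  also have "\<dots> \<le> (3 * (1 + \<bar>y\<bar>)\<^sup>2 * exp (- (u / 2)))\<^sup>2"
  proof -
    have "1 + y\<^sup>2 \<le> (1 + \<bar>y\<bar>)\<^sup>2" by (simp add: power2_eq_square algebra_simps)
    moreover have "1 + 2 * u \<le> 9 * (1 + \<bar>y\<bar>)\<^sup>2"
    proof -
      have "2 * u \<le> 8 * \<bar>y\<bar>" unfolding u_def using pi_less_4 mult_right_mono[of pi 4 "\<bar>y\<bar>"] by simp
      moreover have "8 * \<bar>y\<bar> + 1 \<le> 9 * (1 + \<bar>y\<bar>)\<^sup>2"
        by (simp add: power2_eq_square algebra_simps)
      ultimately show ?thesis by linarith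
    qed
    ultimately have "(1 + y\<^sup>2) * ((1 + 2 * u) * exp (- u))
        \<le> (1 + \<bar>y\<bar>)\<^sup>2 * (9 * (1 + \<bar>y\<bar>)\<^sup>2 * exp (- u))"
      using u by (intro mult_mono mult_right_mono) auto
    also have "\<dots> = (3 * (1 + \<bar>y\<bar>)\<^sup>2 * exp (- (u / 2)))\<^sup>2"
      by (simp add: power2_eq_square algebra_simps exp_add[symmetric])
    finally show ?thesis .
  qed
  finally show ?thesis
    by (rule power2_le_imp_le[THEN order_trans]) (auto simp: u_def)
qed

lemma norm_Gamma_strip_le:
  "\<exists>C>0. \<forall>w. 1 \<le> Re w \<longrightarrow> Re w \<le> 2 \<longrightarrow>
     norm (Gamma w) \<le> C * ((1 + \<bar>Im w\<bar>)\<^sup>2 * exp (- (pi * \<bar>Im w\<bar> / 2)))"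
proof -
  have "compact ((Gamma :: real \<Rightarrow> real) ` {1..2})"
    by (intro compact_continuous_image continuous_intros) (auto elim!: nonpos_Ints_cases)
  then obtain B where "B > 0" and B': "\<forall>g\<in>(Gamma :: real \<Rightarrow> real) ` {1..2}. norm g \<le> B"
    using bounded_pos[of "(Gamma :: real \<Rightarrow> real) ` {1..2}"] compact_imp_bounded by blast
  have B: "Gamma s \<le> B" if "s \<in> {1..2}" for s :: real
    using B' that by force
  have "norm (Gamma w) \<le> 3 * B * ((1 + \<bar>Im w\<bar>)\<^sup>2 * exp (- (pi * \<bar>Im w\<bar> / 2)))"
    if w: "1 \<le> Re w" "Re w \<le> 2" for w
  proof -
    have "norm (rGamma (Complex 2 (Im w))) * rGamma (Re w) \<le> norm (rGamma w)"
      using norm_rGamma_ratio_mono[of "Re w" 2 "Im w"] w Gamma_fact[of 1, where 'a=real]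
      by (simp add: rGamma_inverse_Gamma)
    moreover have "v \<notin> \<int>\<^sub>\<le>\<^sub>0" if "Re v > 0" for v :: complex
    proof
      assume "v \<in> \<int>\<^sub>\<le>\<^sub>0"
      then obtain k where "v = of_int k" "k \<le> 0" by (elim nonpos_Ints_cases)
      then show False using that by simp
    qed
    then have pos: "0 < norm (Gamma (Complex 2 (Im w)))" "0 < Gamma (Re w)" "0 < norm (Gamma w)"
      using w by (auto simp: Gamma_eq_zero_iff intro!: Gamma_real_pos)
    ultimately have "norm (Gamma w) \<le> norm (Gamma (Complex 2 (Im w))) * Gamma (Re w)"
      by (simp add: rGamma_inverse_Gamma norm_inverse norm_divide field_simps)
    also have "\<dots> \<le> (3 * (1 + \<bar>Im w\<bar>)\<^sup>2 * exp (- (pi * \<bar>Im w\<bar> / 2))) * B"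
      using norm_Gamma_two_le[of "Im w"] B[of "Re w"] w pos(2) by (intro mult_mono) auto
    finally show ?thesis by (simp add: mult_ac)
  qed
  then show ?thesis using \<open>B > 0\<close> by (intro exI[of _ "3 * B"]) auto
qed

section \<open>Uniform bound for the Gamma weights\<close>

lemma power_mult_exp_bounded:
  fixes A :: real
  assumes "A \<ge> 0"
  shows "\<exists>K. \<forall>u\<ge>0. (A * (1 + u)) ^ N * exp (- (u / 2)) \<le> K"
proof (cases "N = 0")
  case True
  then show ?thesis by (intro exI[of _ 1]) auto
next
  case False
  have "(A * (1 + u)) ^ N * exp (- (u / 2)) \<le> (A * (2 * real N)) ^ N" if u: "u \<ge> 0" for u
  proof -
    have "u / (2 * real N) + 1 \<le> exp (u / (2 * real N))"
      using exp_ge_add_one_self[of "u / (2 * real N)"] by linarith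
    then have "2 * real N * (u / (2 * real N) + 1) \<le> 2 * real N * exp (u / (2 * real N))"
      by (intro mult_left_mono) auto
    moreover have "1 + u \<le> 2 * real N * (u / (2 * real N) + 1)"
      using False by (simp add: algebra_simps)
    ultimately have "1 + u \<le> 2 * real N * exp (u / (2 * real N))" by linarith
    then have "(A * (1 + u)) ^ N \<le> (A * (2 * real N * exp (u / (2 * real N)))) ^ N"
      using u assms by (intro power_mono mult_left_mono) auto
    also have "\<dots> = (A * (2 * real N)) ^ N * exp (u / 2)"
      using False by (simp add: power_mult_distrib exp_of_nat_mult[symmetric])
    finally have "(A * (1 + u)) ^ N * exp (- (u / 2)) \<le> (A * (2 * real N)) ^ N * exp (u / 2) * exp (- (u / 2))"
      by (intro mult_right_mono) auto
    also have "\<dots> = (A * (2 * real N)) ^ N" by (simp add: mult.assoc exp_add[symmetric])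
    finally show ?thesis .
  qed
  then show ?thesis by blast
qed

text \<open>
  Descending induction: a point of row \<open>n\<close> leaves the hull of row \<open>n + 1\<close> only at the expense of
  the energy of row \<open>n\<close>.
\<close>

lemma rows_bounded_by_energy:
  assumes B: "\<And>j. j \<in> {1..Suc l} \<Longrightarrow> \<bar>X (Suc l) j\<bar> \<le> B"
  defines "E \<equiv> row_energy (\<lambda>a b. \<bar>a - b\<bar>) X"
  shows "n \<le> l \<Longrightarrow> (\<forall>m\<in>{Suc n..l}. 0 \<le> E m) \<and> (\<forall>j\<in>{1..Suc n}. \<bar>X (Suc n) j\<bar> \<le> B + sum E {Suc n..l})"
proof (induction "l - n" arbitrary: n)
  case 0
  then show ?case using B by auto
next
  case (Suc d)
  then have n: "n < l" "d = l - Suc n" by auto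
  then have IH: "\<forall>m\<in>{Suc (Suc n)..l}. 0 \<le> E m"
    and bound: "\<forall>j\<in>{1..Suc (Suc n)}. \<bar>X (Suc (Suc n)) j\<bar> \<le> B + sum E {Suc (Suc n)..l}"
    using Suc.hyps(1)[of "Suc n"] by auto
  have split: "sum E {Suc n..l} = E (Suc n) + sum E {Suc (Suc n)..l}"
    using n by (simp add: sum.atLeast_Suc_atMost)
  have E0: "0 \<le> E (Suc n)"
    unfolding E_def row_energy_def
    by (rule abs_energy_coercive(1)[where B = "B + sum E {Suc (Suc n)..l}"]) (use bound in auto)
  have "\<bar>X (Suc n) j\<bar> \<le> B + sum E {Suc n..l}" if "j \<in> {1..Suc n}" for j
    using abs_energy_coercive(2)[of "{1..Suc n}" "{1..Suc (Suc n)}" "X (Suc (Suc n))"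
        "B + sum E {Suc (Suc n)..l}" j "X (Suc n)"] bound that
    unfolding split by (simp add: E_def row_energy_def)
  moreover have "0 \<le> E m" if "m \<in> {Suc n..l}" for m
    using E0 IH that by (cases "m = Suc n") auto
  ultimately show ?case by blast
qed

text \<open>
  Divided by their limits, the Gamma factors of the numerator decay exponentially and the
  reciprocals of those of the denominator grow exponentially, up to polynomial factors. The
  exponents add up to \<open>- pi / (4 * h)\<close> times the energy \<open>E\<close> of the whole array, plus a boundary
  term which is at most 0, while all distances are at most of order \<open>h + E\<close>. In \<open>u = E / h\<close> a polynomial times \<open>exp (- u / 2)\<close>
  remains, which is bounded uniformly in \<open>h\<close>.
\<close>

lemma Gamma_weight_bounded:
  fixes lam :: "nat \<Rightarrow> real"
  shows "\<exists>K. \<forall>h\<ge>1. \<forall>t. (\<Prod>n=1..l.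
     (\<Prod>k=1..n. \<Prod>m=1..Suc n. (1 + \<bar>re_gam l lam t n k - re_gam l lam t (Suc n) m\<bar> / h)\<^sup>2
         * exp (- (pi * (\<bar>re_gam l lam t n k - re_gam l lam t (Suc n) m\<bar> / h) / 2)))
     * (\<Prod>(s, p)\<in>distinct_pairs n. exp (pi * (\<bar>re_gam l lam t n s - re_gam l lam t n p\<bar> / h) / 2))) \<le> K"
proof -
  define B where "B = (\<Sum>j=1..Suc l. \<bar>lam j\<bar>)"
  have B: "\<bar>lam j\<bar> \<le> B" if "j \<in> {1..Suc l}" for j
    unfolding B_def using that by (intro member_le_sum) auto
  have B0: "B \<ge> 0" by (simp add: B_def sum_nonneg)
  define N where "N = (\<Sum>n=1..l. n * Suc n)"
  obtain K where K: "\<And>u. u \<ge> 0 \<Longrightarrow> ((2 + 2 * B) * (1 + u)) ^ (2 * N) * exp (- (u / 2)) \<le> K"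
    using power_mult_exp_bounded[of "2 + 2 * B" "2 * N"] B0 by auto
  have "(\<Prod>n=1..l.
     (\<Prod>k=1..n. \<Prod>m=1..Suc n. (1 + \<bar>re_gam l lam t n k - re_gam l lam t (Suc n) m\<bar> / h)\<^sup>2
         * exp (- (pi * (\<bar>re_gam l lam t n k - re_gam l lam t (Suc n) m\<bar> / h) / 2)))
     * (\<Prod>(s, p)\<in>distinct_pairs n. exp (pi * (\<bar>re_gam l lam t n s - re_gam l lam t n p\<bar> / h) / 2))) \<le> K"
    (is "?W \<le> K") if h: "h \<ge> 1" for h t
  proof -
    let ?X = "re_gam l lam t" and ?d = "\<lambda>a b::real. \<bar>a - b\<bar>"
    define E where "E = (\<Sum>n=1..l. row_energy ?d ?X n)"
    define c where "c = pi / 2 / h"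
    define S where "S n = (\<Sum>k=1..n. \<Sum>m=1..Suc n. ?d (?X n k) (?X (Suc n) m))" for n
    define P where "P n = pair_energy ?d {1..n} (?X n)" for n
    have lamB: "\<bar>?X (Suc l) j\<bar> \<le> B" if "j \<in> {1..Suc l}" for j
      using B[OF that] by (simp add: re_gam_def)
    have Em: "0 \<le> row_energy ?d ?X m" if "m \<in> {1..l}" for m
      using rows_bounded_by_energy[of l ?X B 0, OF lamB] that by auto
    then have E0: "0 \<le> E" unfolding E_def by (intro sum_nonneg)
    have bound: "\<bar>?X n j\<bar> \<le> B + E" if nj: "n \<in> {1..Suc l}" "j \<in> {1..n}" for n j
    proof -
      obtain n' where n': "n = Suc n'" "n' \<le> l" using nj(1) by (cases n) auto
      have "\<bar>?X n j\<bar> \<le> B + sum (row_energy ?d ?X) {Suc n'..l}"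
        using rows_bounded_by_energy[of l ?X B n', OF lamB] nj n' by auto
      also have "sum (row_energy ?d ?X) {Suc n'..l} \<le> E"
        unfolding E_def using Em by (intro sum_mono2) auto
      finally show ?thesis by simp
    qed
    define u where "u = E / h"
    have u: "u \<ge> 0" using E0 h by (simp add: u_def)
    have small: "1 + ?d (?X n k) (?X (Suc n) m) / h \<le> (2 + 2 * B) * (1 + u)"
      if "n \<in> {1..l}" "k \<in> {1..n}" "m \<in> {1..Suc n}" for n k m
    proof -
      have "?d (?X n k) (?X (Suc n) m) \<le> 2 * (B + E)"
        using bound[of n k] bound[of "Suc n" m] that by auto
      then have "?d (?X n k) (?X (Suc n) m) / h \<le> 2 * (B + E) / h"
        using h by (intro divide_right_mono) auto
      also have "\<dots> = 2 * (B / h) + 2 * u" by (simp add: u_def algebra_simps add_divide_distrib)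
      also have "B / h \<le> B" using h B0 by (simp add: divide_le_eq mult_left_mono[of 1 h B, simplified])
      finally show ?thesis using mult_nonneg_nonneg[OF B0 u] by (simp add: algebra_simps)
    qed
    have poly: "(\<Prod>n=1..l. \<Prod>k=1..n. \<Prod>m=1..Suc n. (1 + ?d (?X n k) (?X (Suc n) m) / h)\<^sup>2)
        \<le> ((2 + 2 * B) * (1 + u)) ^ (2 * N)"
    proof -
      have "(\<Prod>n=1..l. \<Prod>k=1..n. \<Prod>m=1..Suc n. (1 + ?d (?X n k) (?X (Suc n) m) / h)\<^sup>2)
          \<le> (\<Prod>n=1..l. \<Prod>k=1..n. \<Prod>m=1..Suc n. ((2 + 2 * B) * (1 + u))\<^sup>2)"
        using small h by (intro prod_mono power_mono conjI prod_nonneg ballI) auto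
      also have "\<dots> = (\<Prod>n=1..l. (((2 + 2 * B) * (1 + u))\<^sup>2) ^ (n * Suc n))"
        by (simp only: prod_constant card_atLeastAtMost diff_Suc_1 power_mult[symmetric] mult_ac)
      also have "\<dots> = ((2 + 2 * B) * (1 + u)) ^ (2 * N)"
        by (simp only: N_def power_mult[of _ 2 "\<Sum>n=1..l. n * Suc n"] power_sum)
      finally show ?thesis .
    qed
    have "(\<Sum>n=1..l. 2 * (S n - P n)) = E + pair_energy ?d {1..Suc l} (?X (Suc l))"
      unfolding S_def P_def E_def by (rule row_energy_telescope)
    moreover have "0 \<le> pair_energy ?d {1..Suc l} (?X (Suc l))" by (rule pair_energy_nonneg) simp
    ultimately have SP: "E \<le> 2 * (\<Sum>n=1..l. S n - P n)"
      unfolding sum_distrib_left[symmetric] by linarith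
    have "?W = (\<Prod>n=1..l. (\<Prod>k=1..n. \<Prod>m=1..Suc n. (1 + ?d (?X n k) (?X (Suc n) m) / h)\<^sup>2)
        * exp (- c * (S n - P n)))"
    proof (rule prod.cong)
      fix n
      have "(\<Prod>(s, p)\<in>distinct_pairs n. exp (pi * (?d (?X n s) (?X n p) / h) / 2)) = exp (c * P n)"
        unfolding P_def pair_energy_distinct_pairs sum_distrib_left
        by (simp add: exp_sum finite_distinct_pairs case_prod_beta c_def mult_ac)
      moreover have "(\<Prod>k=1..n. \<Prod>m=1..Suc n. exp (- (pi * (?d (?X n k) (?X (Suc n) m) / h) / 2))) = exp (- c * S n)"
        unfolding S_def sum_distrib_left exp_sum[OF finite_atLeastAtMost] by (simp add: c_def mult_ac)
      moreover have "exp (- c * S n) * exp (c * P n) = exp (- c * (S n - P n))"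
        unfolding exp_add[symmetric] by (simp add: algebra_simps)
      ultimately show "(\<Prod>k=1..n. \<Prod>m=1..Suc n. (1 + ?d (?X n k) (?X (Suc n) m) / h)\<^sup>2
         * exp (- (pi * (?d (?X n k) (?X (Suc n) m) / h) / 2)))
         * (\<Prod>(s, p)\<in>distinct_pairs n. exp (pi * (?d (?X n s) (?X n p) / h) / 2))
        = (\<Prod>k=1..n. \<Prod>m=1..Suc n. (1 + ?d (?X n k) (?X (Suc n) m) / h)\<^sup>2)
          * exp (- c * (S n - P n))"
        unfolding prod.distrib by (simp only: mult.assoc)
    qed simp
    also have "\<dots> = (\<Prod>n=1..l. \<Prod>k=1..n. \<Prod>m=1..Suc n. (1 + ?d (?X n k) (?X (Suc n) m) / h)\<^sup>2)
        * exp (- c * (\<Sum>n=1..l. S n - P n))"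
      unfolding prod.distrib sum_distrib_left exp_sum[OF finite_atLeastAtMost] ..
    also have "\<dots> \<le> ((2 + 2 * B) * (1 + u)) ^ (2 * N) * exp (- (u / 2))"
    proof (intro mult_mono poly)
      have "pi / 4 * u \<le> c * (\<Sum>n=1..l. S n - P n)"
        using mult_left_mono[OF SP, of "pi / 4 / h"] h by (simp add: c_def u_def)
      moreover have "u / 2 \<le> pi / 4 * u" using mult_right_mono[OF pi_ge_two u] by simp
      ultimately show "exp (- c * (\<Sum>n=1..l. S n - P n)) \<le> exp (- (u / 2))" by simp
    qed (use u B0 in auto)
    also have "\<dots> \<le> K" by (rule K[OF u])
    finally show ?thesis .
  qed
  then show ?thesis by blast
qed

section \<open>The rescaled Gamma factors\<close>

lemma of_real_powr_eq_exp:
  fixes h :: real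
  assumes "h > 0"
  shows "complex_of_real h powr (z / of_real h) = exp (z * of_real (ln h / h))"
  using assms by (simp add: powr_def Ln_of_real)

text \<open>
  The pole of \<open>Gamma\<close> at 0 is the source of the limit \<open>1 / z\<close>; what multiplies it tends to 1.
\<close>

lemma Gamma1_over_eq:
  assumes "h > 0" "Re z > 0"
  shows "Gamma1 z h / of_real h = exp (z * of_real (ln h / h)) * Gamma (1 + z / of_real h) / z"
proof -
  have "z / of_real h \<notin> \<int>\<^sub>\<le>\<^sub>0"
  proof
    assume "z / of_real h \<in> \<int>\<^sub>\<le>\<^sub>0"
    then obtain k where k: "z / of_real h = of_int k" "k \<le> 0" by (elim nonpos_Ints_cases)
    then have "Re (z / of_real h) = of_int k" by simp
    moreover have "Re (z / of_real h) > 0" using assms by (simp add: Re_divide_of_real)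
    ultimately show False using k(2) by simp
  qed
  then have "Gamma (1 + z / of_real h) = z / of_real h * Gamma (z / of_real h)"
    using Gamma_plus1[of "z / of_real h"] by (simp add: add.commute)
  moreover have "z \<noteq> 0" using assms by auto
  ultimately show ?thesis using assms by (simp add: Gamma1_def of_real_powr_eq_exp)
qed

lemma inverse_Gamma1_eq:
  assumes "h > 0"
  shows "of_real h * inverse (Gamma1 z h) = exp (- z * of_real (ln h / h)) * (of_real h * rGamma (z / of_real h))"
  using assms by (simp add: Gamma1_def of_real_powr_eq_exp rGamma_inverse_Gamma exp_minus)

lemma scaled_rGamma_eq:
  assumes "h > 0"
  shows "of_real h * rGamma (z / of_real h) = z * rGamma (1 + z / of_real h)"
  using assms rGamma_plus1[of "z / of_real h"] by (simp add: add.commute field_simps)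

lemma tendsto_exp_ln_over: "((\<lambda>h. exp (z * of_real (ln h / h))) \<longlongrightarrow> (1::complex)) at_top"
proof -
  have "((\<lambda>h. exp (z * of_real (ln h / h))) \<longlongrightarrow> exp (z * of_real 0)) at_top"
    by (intro tendsto_intros ln_x_over_x_tendsto_0)
  then show ?thesis by simp
qed

lemma tendsto_one_plus_over: "((\<lambda>h. 1 + z / of_real h) \<longlongrightarrow> (1::complex)) at_top"
proof -
  have "((\<lambda>h. 1 + z * of_real (inverse h)) \<longlongrightarrow> 1 + z * of_real 0) at_top"
    by (intro tendsto_intros tendsto_inverse_0_at_top filterlim_ident)
  then show ?thesis by (simp add: divide_inverse)
qed

lemma tendsto_Gamma1_over:
  assumes "Re z > 0"
  shows "((\<lambda>h. Gamma1 z h / of_real h) \<longlongrightarrow> 1 / z) at_top"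
proof -
  have "((\<lambda>h. exp (z * of_real (ln h / h)) * Gamma (1 + z / of_real h) / z) \<longlongrightarrow> 1 * Gamma 1 / z) at_top"
    using assms by (intro tendsto_intros tendsto_exp_ln_over tendsto_one_plus_over) auto
  moreover have "\<forall>\<^sub>F h in at_top. exp (z * of_real (ln h / h)) * Gamma (1 + z / of_real h) / z
      = Gamma1 z h / of_real h"
    using eventually_gt_at_top[of 0] by eventually_elim (simp add: Gamma1_over_eq assms)
  ultimately show ?thesis by (simp add: tendsto_cong)
qed

lemma tendsto_inverse_Gamma1:
  "((\<lambda>h. of_real h * inverse (Gamma1 z h)) \<longlongrightarrow> z) at_top"
proof -
  have "((\<lambda>h. rGamma (1 + z / of_real h)) \<longlongrightarrow> rGamma 1) at_top"
    by (rule continuous_on_tendsto_compose[OF continuous_on_rGamma[of UNIV]])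
       (auto intro: tendsto_one_plus_over)
  then have "((\<lambda>h. exp (- z * of_real (ln h / h)) * (z * rGamma (1 + z / of_real h))) \<longlongrightarrow> 1 * (z * rGamma 1)) at_top"
    by (intro tendsto_intros tendsto_exp_ln_over)
  moreover have "\<forall>\<^sub>F h in at_top. exp (- z * of_real (ln h / h)) * (z * rGamma (1 + z / of_real h))
      = of_real h * inverse (Gamma1 z h)"
    using eventually_gt_at_top[of 0]
    by eventually_elim (simp only: inverse_Gamma1_eq scaled_rGamma_eq)
  ultimately show ?thesis by (simp add: tendsto_cong)
qed

lemma norm_Gamma1_over_le:
  "\<exists>C>0. \<forall>h z D. 1 \<le> h \<longrightarrow> 0 < Re z \<longrightarrow> Re z \<le> D \<longrightarrow> D \<le> h \<longrightarrow>
     norm (Gamma1 z h / of_real h)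
       \<le> exp D * C * ((1 + \<bar>Im z\<bar> / h)\<^sup>2 * exp (- (pi * (\<bar>Im z\<bar> / h) / 2))) / norm z"
proof -
  obtain C where "C > 0" and C: "\<And>w. 1 \<le> Re w \<Longrightarrow> Re w \<le> 2 \<Longrightarrow>
     norm (Gamma w) \<le> C * ((1 + \<bar>Im w\<bar>)\<^sup>2 * exp (- (pi * \<bar>Im w\<bar> / 2)))"
    using norm_Gamma_strip_le by blast
  have "norm (Gamma1 z h / of_real h)
       \<le> exp D * C * ((1 + \<bar>Im z\<bar> / h)\<^sup>2 * exp (- (pi * (\<bar>Im z\<bar> / h) / 2))) / norm z"
    if h: "1 \<le> h" "0 < Re z" "Re z \<le> D" "D \<le> h" for h D :: real and z
  proof -
    have "ln h / h \<le> 1" "0 \<le> ln h / h" using ln_le_minus_one[of h] h by (auto simp: divide_le_eq)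
    then have "Re z * (ln h / h) \<le> D * 1" using h by (intro mult_mono) auto
    then have e: "norm (exp (z * of_real (ln h / h))) \<le> exp D" by simp
    have "norm (Gamma (1 + z / of_real h)) \<le> C * ((1 + \<bar>Im z\<bar> / h)\<^sup>2 * exp (- (pi * (\<bar>Im z\<bar> / h) / 2)))"
      using C[of "1 + z / of_real h"] h by (simp add: Re_divide_of_real Im_divide_of_real divide_le_eq)
    then have "norm (exp (z * of_real (ln h / h))) * norm (Gamma (1 + z / of_real h)) / norm z
        \<le> exp D * (C * ((1 + \<bar>Im z\<bar> / h)\<^sup>2 * exp (- (pi * (\<bar>Im z\<bar> / h) / 2)))) / norm z"
      using e by (intro divide_right_mono mult_mono) auto
    moreover have "norm (Gamma1 z h / of_real h)
        = norm (exp (z * of_real (ln h / h))) * norm (Gamma (1 + z / of_real h)) / norm z"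
      using h by (subst Gamma1_over_eq) (auto simp: norm_mult norm_divide)
    ultimately show ?thesis by (simp only: mult.assoc)
  qed
  then show ?thesis using \<open>C > 0\<close> by blast
qed

lemma norm_inverse_Gamma1_pair_le:
  assumes "h > 0"
  shows "norm (of_real h * inverse (Gamma1 z h)) * norm (of_real h * inverse (Gamma1 (- z) h))
      \<le> (norm z * exp (pi * (\<bar>Im z\<bar> / h) / 2))\<^sup>2"
proof -
  have "norm (of_real h * inverse (Gamma1 z h)) * norm (of_real h * inverse (Gamma1 (- z) h))
     = h\<^sup>2 * (norm (rGamma (z / of_real h)) * norm (rGamma (- (z / of_real h))))"
  proof -
    let ?e = "\<lambda>z. exp (- z * of_real (ln h / h)) :: complex"
    have "norm (?e z) * norm (?e (- z)) = 1"
      unfolding norm_mult[symmetric] by (simp add: mult_exp_exp)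
    moreover have "norm (of_real h * inverse (Gamma1 z h)) * norm (of_real h * inverse (Gamma1 (- z) h))
       = (norm (?e z) * norm (?e (- z)))
         * (h\<^sup>2 * (norm (rGamma (z / of_real h)) * norm (rGamma (- (z / of_real h)))))"
      unfolding inverse_Gamma1_eq[OF assms]
      using assms by (simp only: norm_mult power2_eq_square mult_ac norm_of_real abs_of_pos minus_divide_left)
    ultimately show ?thesis by simp
  qed
  also have "\<dots> \<le> h\<^sup>2 * ((norm (z / of_real h))\<^sup>2 * exp (pi * \<bar>Im (z / of_real h)\<bar>))"
    by (intro mult_left_mono norm_rGamma_pair_le) auto
  also have "\<dots> = (norm z)\<^sup>2 * exp (pi * (\<bar>Im z\<bar> / h))"
    using assms by (simp add: norm_divide power_divide Im_divide_of_real)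
  also have "\<dots> = (norm z * exp (pi * (\<bar>Im z\<bar> / h) / 2))\<^sup>2"
    by (simp add: power_mult_distrib exp_double[symmetric] power2_eq_square exp_add[symmetric])
  finally show ?thesis .
qed

text \<open>
  A bound for the product of the factors at \<open>(s, p)\<close> and \<open>(p, s)\<close> suffices: square the whole
  product and swap the indices in one copy.
\<close>

lemma prod_distinct_pairs_le:
  fixes F G :: "nat \<times> nat \<Rightarrow> real"
  assumes F: "\<And>s p. (s, p) \<in> distinct_pairs n \<Longrightarrow> 0 \<le> F (s, p)"
    and G: "\<And>s p. (s, p) \<in> distinct_pairs n \<Longrightarrow> 0 \<le> G (s, p)"
    and le: "\<And>s p. (s, p) \<in> distinct_pairs n \<Longrightarrow> F (s, p) * F (p, s) \<le> (G (s, p))\<^sup>2"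
  shows "prod F (distinct_pairs n) \<le> prod G (distinct_pairs n)"
proof (rule power2_le_imp_le)
  have "prod (\<lambda>(s, p). F (p, s)) (distinct_pairs n) = prod F (distinct_pairs n)"
    by (rule prod.reindex_bij_witness[of _ prod.swap prod.swap]) (auto simp: distinct_pairs_def)
  then have "(prod F (distinct_pairs n))\<^sup>2 = prod (\<lambda>(s, p). F (s, p) * F (p, s)) (distinct_pairs n)"
    by (simp add: power2_eq_square case_prod_beta prod.distrib)
  also have "\<dots> \<le> prod (\<lambda>v. (G v)\<^sup>2) (distinct_pairs n)"
  proof (rule prod_mono)
    fix v assume v: "v \<in> distinct_pairs n"
    obtain s p where sp: "v = (s, p)" by (cases v)
    have "(p, s) \<in> distinct_pairs n" using v sp by (auto simp: distinct_pairs_def)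
    then show "0 \<le> (case v of (s, p) \<Rightarrow> F (s, p) * F (p, s)) \<and>
        (case v of (s, p) \<Rightarrow> F (s, p) * F (p, s)) \<le> (G v)\<^sup>2"
      using v sp F le by (auto intro!: mult_nonneg_nonneg)
  qed
  also have "\<dots> = (prod G (distinct_pairs n))\<^sup>2" by (simp add: prod_power_distrib)
  finally show "(prod F (distinct_pairs n))\<^sup>2 \<le> (prod G (distinct_pairs n))\<^sup>2" .
  show "0 \<le> prod G (distinct_pairs n)" using G by (intro prod_nonneg) auto
qed

section \<open>The integrands and their rescaling\<close>

text \<open>
  The imaginary part of \<open>gam\<close>, as \<open>re_gam\<close> is its real part.
\<close>

definition im_gam :: "nat \<Rightarrow> (nat \<times> nat \<Rightarrow> real) \<Rightarrow> nat \<Rightarrow> nat \<Rightarrow> real" where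
  "im_gam l eps n j = (if n = l + 1 then 0 else - eps (n, j))"

lemma gam_eq_Complex:
  "j \<le> n \<Longrightarrow> gam l lam eps t n j = Complex (re_gam l lam t n j) (im_gam l eps n j)"
  by (simp add: gam_def re_gam_def im_gam_def complex_eq_iff)

lemma gam_beyond_diagonal: "n < j \<Longrightarrow> gam l lam eps t n j = 0"
  by (simp add: gam_def)

lemma im_gam_less:
  assumes "admissible l lam eps" "n \<in> {1..l}" "m \<in> {1..n}" "k \<in> {1..Suc n}"
  shows "im_gam l eps n m < im_gam l eps (Suc n) k"
proof -
  let ?g = "gam l lam eps (\<lambda>_. 0)"
  have "Im (?g n m) \<le> Max ((\<lambda>j. Im (?g n j)) ` {1..n})"
    using assms by (intro Max_ge) auto
  also have "\<dots> < Min ((\<lambda>m. Im (?g (n + 1) m)) ` {1..n + 1})"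
    using assms by (simp add: admissible_def)
  also have "\<dots> \<le> Im (?g (n + 1) k)"
    using assms by (intro Min_le) auto
  finally show ?thesis using assms by (simp add: gam_eq_Complex)
qed

text \<open>
  The distance \<open>\<delta>\<close> between neighbouring rows of lines keeps the integrands away from the poles, also in
  the limit.
\<close>

lemma im_gam_bounds:
  assumes "admissible l lam eps"
  obtains \<delta> D where "0 < \<delta>" "\<delta> \<le> 1"
    "\<And>n m k. n \<in> {1..l} \<Longrightarrow> m \<in> {1..n} \<Longrightarrow> k \<in> {1..Suc n} \<Longrightarrow>
        \<delta> \<le> im_gam l eps (Suc n) k - im_gam l eps n m"
    "\<And>n j. n \<in> {1..Suc l} \<Longrightarrow> j \<in> {1..n} \<Longrightarrow> \<bar>im_gam l eps n j\<bar> \<le> D"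
proof
  let ?S = "SIGMA n:{1..l}. {1..n} \<times> {1..Suc n}"
  let ?f = "\<lambda>(n, m, k). im_gam l eps (Suc n) k - im_gam l eps n m"
  have fin: "finite (insert 1 (?f ` ?S))" by auto
  show "0 < Min (insert 1 (?f ` ?S))"
    using im_gam_less[OF assms] by (subst Min_gr_iff) auto
  show "Min (insert 1 (?f ` ?S)) \<le> 1" using fin by (intro Min_le) auto
  show "Min (insert 1 (?f ` ?S)) \<le> im_gam l eps (Suc n) k - im_gam l eps n m"
    if "n \<in> {1..l}" "m \<in> {1..n}" "k \<in> {1..Suc n}" for n m k
  proof (rule Min_le[OF fin])
    have "?f (n, m, k) \<in> ?f ` ?S" using that by (intro imageI) auto
    then show "im_gam l eps (Suc n) k - im_gam l eps n m \<in> insert 1 (?f ` ?S)" by simp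
  qed
  show "\<bar>im_gam l eps n j\<bar> \<le> (\<Sum>n=1..Suc l. \<Sum>j=1..n. \<bar>im_gam l eps n j\<bar>)"
    if "n \<in> {1..Suc l}" "j \<in> {1..n}" for n j
  proof -
    have "\<bar>im_gam l eps n j\<bar> \<le> (\<Sum>j=1..n. \<bar>im_gam l eps n j\<bar>)"
      using that by (intro member_le_sum[of j "{1..n}" "\<lambda>j. \<bar>im_gam l eps n j\<bar>"]) auto
    also have "\<dots> \<le> (\<Sum>n=1..Suc l. \<Sum>j=1..n. \<bar>im_gam l eps n j\<bar>)"
      using that by (intro member_le_sum[of n "{1..Suc l}" "\<lambda>n. \<Sum>j=1..n. \<bar>im_gam l eps n j\<bar>"])
        (auto intro: sum_nonneg)
    finally show ?thesis .
  qed
qed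

text \<open>
  The two Whittaker functions have the same integrand up to the choice of \<open>U\<close> and \<open>V\<close>: for the
  classical one \<open>U z = Gamma1 z h / h\<close> and \<open>V z = h / Gamma1 z h\<close>, for the elementary one the limits
  \<open>1 / z\<close> and \<open>z\<close> of these.
\<close>

definition gt_integrand ::
  "(complex \<Rightarrow> complex) \<Rightarrow> (complex \<Rightarrow> complex) \<Rightarrow> nat \<Rightarrow> (nat \<times> nat \<Rightarrow> real) \<Rightarrow> (nat \<Rightarrow> real) \<Rightarrow>
     (nat \<Rightarrow> real) \<Rightarrow> (nat \<times> nat \<Rightarrow> real) \<Rightarrow> complex"
where
  "gt_integrand U V l eps lam x t =
     (let g = gam l lam eps t in
        (\<Prod>n=1..l. (\<Prod>k=1..Suc n. \<Prod>m=1..n. U ((g (Suc n) k - g n m) / \<i>))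
                  * (\<Prod>(s, p)\<in>distinct_pairs n. V ((g n s - g n p) / \<i>)) / fact n)
        * exp (\<i> * phase l x g)
        * (\<Prod>n=1..l. \<Prod>j=1..n. 1 / (2 * of_real pi)))"

lemma card_distinct_pairs: "card (distinct_pairs n) = n * (n - 1)"
proof -
  have "distinct_pairs n = (SIGMA s:{1..n}. {1..n} - {s})"
    by (auto simp: distinct_pairs_def)
  then show ?thesis by (simp add: card_SigmaI)
qed

lemma sum_atLeast1_atMost_id: fixes l :: nat shows "(\<Sum>n=1..l. n) = l * (l + 1) div 2"
  by (induction l) auto

lemma real_sum_atLeast1_atMost_id: fixes l :: nat shows "real (\<Sum>n=1..l. n) = real l * (real l + 1) / 2"
  by (induction l) (auto simp: field_simps)

lemma prod_rows_const:
  fixes c :: "'a :: comm_monoid_mult"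
  shows "(\<Prod>n=1..l. \<Prod>j=1..n. c) = c ^ (\<Sum>n=1..l. n)"
  by (simp only: power_sum prod_constant card_atLeastAtMost diff_Suc_1)

lemma prod_rows_measure:
  fixes H :: complex
  shows "(\<Prod>n=1..l. \<Prod>j=1..n. 1 / (2 * of_real pi * H))
     = (\<Prod>n=1..l. \<Prod>j=1..n. 1 / (2 * of_real pi)) * inverse (H ^ (\<Sum>n=1..l. n))"
proof -
  have "1 / (2 * of_real pi * H) = 1 / (2 * of_real pi) * inverse H"
    by (simp only: divide_inverse inverse_mult_distrib mult.assoc)
  then have "(\<Prod>n=1..l. \<Prod>j=1..n. 1 / (2 * of_real pi * H))
     = (\<Prod>n=1..l. \<Prod>j=1..n. 1 / (2 * of_real pi)) * inverse H ^ (\<Sum>n=1..l. n)"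
    by (simp only: prod.distrib prod_rows_const)
  then show ?thesis unfolding power_inverse .
qed

lemma phase_scale: "phase l (\<lambda>n. h * x n) g = of_real h * phase l x g"
  unfolding phase_def sum_distrib_left by (intro sum.cong) (auto simp: mult_ac)

text \<open>
  Counting powers of \<open>h\<close>: row \<open>n\<close> has \<open>n * (n + 1)\<close> Gamma factors in the numerator and
  \<open>n * (n - 1)\<close> in the denominator, which gives \<open>h ^ (2 * n)\<close>. Half of it cancels against the
  measure, the other half against the prefactor.
\<close>

lemma classical_whittaker_rescaled:
  assumes "h > 0"
  shows "of_real (h powr (- (real l * (real l + 1) / 2)))
            * classical_whittaker l eps lam (\<lambda>n. h * x n) h
         = (LINT t | Pi\<^sub>M (triangle l) (\<lambda>_. lborel).
              gt_integrand (\<lambda>z. Gamma1 z h / of_real h) (\<lambda>z. of_real h * inverse (Gamma1 z h)) l eps lam x t)"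
proof -
  define N where "N = (\<Sum>n=1..l. n)"
  define H where "H = complex_of_real h"
  have H: "H \<noteq> 0" using assms by (simp add: H_def)
  have pre: "complex_of_real (h powr (- (real l * (real l + 1) / 2))) = inverse (H ^ N)"
    using assms unfolding real_sum_atLeast1_atMost_id[symmetric] N_def[symmetric] H_def
    by (simp add: powr_minus powr_realpow of_real_inverse)
  have measure: "(\<Prod>n=1..l. \<Prod>j=1..n. 1 / (2 * of_real pi * H))
      = (\<Prod>n=1..l. \<Prod>j=1..n. 1 / (2 * of_real pi)) * inverse (H ^ N)"
    unfolding N_def by (rule prod_rows_measure)
  have rows: "(\<Prod>n=1..l. (\<Prod>k=1..Suc n. \<Prod>m=1..n. a n k m / H) * (\<Prod>(s, p)\<in>distinct_pairs n. H * inverse (b n s p)) / fact n)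
      = (\<Prod>n=1..l. (\<Prod>k=1..Suc n. \<Prod>m=1..n. a n k m) / (fact n * (\<Prod>(s, p)\<in>distinct_pairs n. b n s p)))
        * inverse (H ^ N) * inverse (H ^ N)" for a b :: "nat \<Rightarrow> nat \<Rightarrow> nat \<Rightarrow> complex"
  proof -
    have "(\<Prod>k=1..Suc n. \<Prod>m=1..n. a n k m / H) * (\<Prod>(s, p)\<in>distinct_pairs n. H * inverse (b n s p)) / fact n
       = (\<Prod>k=1..Suc n. \<Prod>m=1..n. a n k m) / (fact n * (\<Prod>(s, p)\<in>distinct_pairs n. b n s p))
          * (inverse (H ^ n) * inverse (H ^ n))" for n
    proof -
      have num: "(\<Prod>k=1..Suc n. \<Prod>m=1..n. a n k m / H) = (\<Prod>k=1..Suc n. \<Prod>m=1..n. a n k m) / H ^ (n * Suc n)"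
        by (simp only: prod_dividef prod_constant card_atLeastAtMost diff_Suc_1 power_mult[symmetric])
      have den: "(\<Prod>(s, p)\<in>distinct_pairs n. H * inverse (b n s p))
          = H ^ (n * (n - 1)) * inverse (\<Prod>(s, p)\<in>distinct_pairs n. b n s p)"
        by (simp add: case_prod_beta prod.distrib card_distinct_pairs prod_inversef[symmetric] o_def)
      have "n * Suc n = n * (n - 1) + n + n" by (cases n) auto
      then have "H ^ (n * Suc n) = H ^ (n * (n - 1)) * H ^ n * H ^ n" by (simp only: power_add)
      then show ?thesis unfolding num den using H by (simp add: field_simps)
    qed
    moreover have "(\<Prod>n=1..l. inverse (H ^ n)) = inverse (H ^ N)"
      unfolding N_def power_sum prod_inversef[symmetric] by (simp add: o_def)
    ultimately show ?thesis by (simp only: prod.distrib mult.assoc)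
  qed
  have "\<i> / H * phase l (\<lambda>n. h * x n) g = \<i> * phase l x g" for g
    using H by (simp add: phase_scale H_def)
  then show ?thesis
    unfolding classical_whittaker_def integral_mult_right_zero[symmetric] gt_integrand_def Let_def pre
      H_def[symmetric] measure rows Suc_eq_plus1[symmetric]
    by (simp only: mult_ac)
qed

text \<open>
  The same count for powers of \<open>\<i>\<close>: row \<open>n\<close> contributes \<open>(- \<i>) ^ (2 * n)\<close>, which the prefactor and the
  measure provide in equal parts.
\<close>

lemma elementary_whittaker_eq:
  "elementary_whittaker l eps lam x
     = (LINT t | Pi\<^sub>M (triangle l) (\<lambda>_. lborel). gt_integrand (\<lambda>z. 1 / z) (\<lambda>z. z) l eps lam x t)"
proof -
  define N where "N = (\<Sum>n=1..l. n)"
  have pre: "\<i> powi (- int (l * (l + 1) div 2)) = (- \<i>) ^ N"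
    unfolding sum_atLeast1_atMost_id[symmetric] N_def[symmetric]
    by (simp add: power_int_minus power_inverse[symmetric])
  have measure: "(\<Prod>n=1..l. \<Prod>j=1..n. 1 / (2 * of_real pi * \<i>))
      = (\<Prod>n=1..l. \<Prod>j=1..n. 1 / (2 * of_real pi)) * (- \<i>) ^ N"
    unfolding prod_rows_measure N_def[symmetric] power_inverse[symmetric] by simp
  have rows: "(\<Prod>n=1..l. (\<Prod>k=1..Suc n. \<Prod>m=1..n. 1 / ((g (Suc n) k - g n m) / \<i>))
            * (\<Prod>(s, p)\<in>distinct_pairs n. (g n s - g n p) / \<i>) / fact n)
      = (\<Prod>n=1..l. (\<Prod>(s, p)\<in>distinct_pairs n. g n s - g n p)
              / (fact n * (\<Prod>k=1..n. \<Prod>m=1..Suc n. g n k - g (Suc n) m))) * (- \<i>) ^ N * (- \<i>) ^ N"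
    for g :: "nat \<Rightarrow> nat \<Rightarrow> complex"
  proof -
    have "(\<Prod>k=1..Suc n. \<Prod>m=1..n. 1 / ((g (Suc n) k - g n m) / \<i>))
            * (\<Prod>(s, p)\<in>distinct_pairs n. (g n s - g n p) / \<i>) / fact n
       = (\<Prod>(s, p)\<in>distinct_pairs n. g n s - g n p)
              / (fact n * (\<Prod>k=1..n. \<Prod>m=1..Suc n. g n k - g (Suc n) m)) * ((- \<i>) ^ n * (- \<i>) ^ n)" for n
    proof -
      have "(\<Prod>k=1..Suc n. \<Prod>m=1..n. 1 / ((g (Suc n) k - g n m) / \<i>))
          = (\<Prod>k=1..n. \<Prod>m=1..Suc n. (- \<i>) / (g n k - g (Suc n) m))"
        by (subst prod.swap) (intro prod.cong refl, simp add: divide_simps)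
      also have "\<dots> = (- \<i>) ^ (Suc n * n) / (\<Prod>k=1..n. \<Prod>m=1..Suc n. g n k - g (Suc n) m)"
        by (simp only: prod_dividef prod_constant card_atLeastAtMost diff_Suc_1 power_mult[symmetric])
      finally have num: "(\<Prod>k=1..Suc n. \<Prod>m=1..n. 1 / ((g (Suc n) k - g n m) / \<i>))
          = (- \<i>) ^ (Suc n * n) / (\<Prod>k=1..n. \<Prod>m=1..Suc n. g n k - g (Suc n) m)" .
      have den: "(\<Prod>(s, p)\<in>distinct_pairs n. (g n s - g n p) / \<i>)
          = (- \<i>) ^ (n * (n - 1)) * (\<Prod>(s, p)\<in>distinct_pairs n. g n s - g n p)"
      proof -
        have "(\<Prod>(s, p)\<in>distinct_pairs n. (g n s - g n p) / \<i>)
            = (\<Prod>v\<in>distinct_pairs n. (- \<i>) * (case v of (s, p) \<Rightarrow> g n s - g n p))"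
          by (intro prod.cong) (auto simp: algebra_simps)
        then show ?thesis by (simp only: prod.distrib prod_constant card_distinct_pairs)
      qed
      have "(- \<i>) ^ (Suc n * n) * (- \<i>) ^ (n * (n - 1)) = (- \<i>) ^ n * (- \<i>) ^ n"
      proof -
        have "Suc n * n + n * (n - 1) = 2 * (n * n)" by (cases n) auto
        then have "(- \<i>) ^ (Suc n * n) * (- \<i>) ^ (n * (n - 1)) = ((- \<i>)\<^sup>2) ^ (n * n)"
          unfolding power_add[symmetric] by (simp only: power_mult[of _ 2 "n * n"])
        also have "\<dots> = (-1) ^ (n * n)" by simp
        also have "\<dots> = (-1 :: complex) ^ n" by (cases "even n") auto
        also have "\<dots> = (- \<i>) ^ n * (- \<i>) ^ n" by (simp flip: power_mult_distrib)
        finally show ?thesis .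
      qed
      then show ?thesis unfolding num den by (simp add: mult_ac)
    qed
    moreover have "(\<Prod>n=1..l. (- \<i>) ^ n) = (- \<i>) ^ N" by (simp add: N_def power_sum)
    ultimately show ?thesis by (simp only: prod.distrib mult.assoc)
  qed
  show ?thesis
    unfolding elementary_whittaker_def pre
    unfolding integral_mult_right_zero[symmetric] gt_integrand_def Let_def measure rows Suc_eq_plus1[symmetric]
    by (simp only: mult_ac)
qed

section \<open>Dominated convergence\<close>

lemma borel_measurable_Gamma_complex [measurable]: "(Gamma :: complex \<Rightarrow> complex) \<in> borel_measurable borel"
proof -
  have "(\<lambda>z :: complex. inverse (rGamma z)) \<in> borel_measurable borel"
    by (intro borel_measurable_inverse borel_measurable_continuous_onI continuous_on_rGamma)
  then show ?thesis by (simp add: rGamma_inverse_Gamma)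
qed

lemma borel_measurable_Gamma1 [measurable]: "(\<lambda>z. Gamma1 z h) \<in> borel_measurable borel"
  unfolding Gamma1_def powr_def by (cases "h = 0") simp_all

lemma borel_measurable_gam [measurable]:
  "(\<lambda>t. gam l lam eps t n j) \<in> borel_measurable (Pi\<^sub>M S (\<lambda>_. lborel))"
proof (cases "n < j")
  case True
  then show ?thesis by (simp add: gam_beyond_diagonal)
next
  case False
  have "(\<lambda>t. of_real (re_gam l lam t n j) + \<i> * of_real (im_gam l eps n j))
      \<in> borel_measurable (Pi\<^sub>M S (\<lambda>_. lborel :: real measure))" by measurable
  then show ?thesis using False by (simp add: gam_eq_Complex Complex_eq)
qed

lemma borel_measurable_gt_integrand:
  assumes [measurable]: "U \<in> borel_measurable borel" "V \<in> borel_measurable borel"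
  shows "gt_integrand U V l eps lam x \<in> borel_measurable (Pi\<^sub>M (triangle l) (\<lambda>_. lborel))"
  unfolding gt_integrand_def[abs_def] Let_def phase_def case_prod_beta by measurable

text \<open>
  Only the imaginary parts of the variables enter, and these are constant along the lines.
\<close>

lemma norm_exp_phase:
  "norm (exp (\<i> * phase l x (gam l lam eps t))) = norm (exp (\<i> * phase l x (gam l lam eps (\<lambda>_. 0))))"
proof -
  have "Im (gam l lam eps t n j) = Im (gam l lam eps (\<lambda>_. 0) n j)" for n j
    by (cases "n < j") (auto simp: gam_beyond_diagonal gam_eq_Complex)
  then have "Im (phase l x (gam l lam eps t)) = Im (phase l x (gam l lam eps (\<lambda>_. 0)))"
    by (simp add: phase_def)
  then show ?thesis by simp
qed

lemma gt_integrand_rescaled_tendsto: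
  assumes "admissible l lam eps"
  shows "((\<lambda>h. gt_integrand (\<lambda>z. Gamma1 z h / of_real h) (\<lambda>z. of_real h * inverse (Gamma1 z h)) l eps lam x t)
           \<longlongrightarrow> gt_integrand (\<lambda>z. 1 / z) (\<lambda>z. z) l eps lam x t) at_top"
proof -
  let ?g = "gam l lam eps t"
  have U: "((\<lambda>h. Gamma1 ((?g (Suc n) k - ?g n m) / \<i>) h / of_real h)
      \<longlongrightarrow> 1 / ((?g (Suc n) k - ?g n m) / \<i>)) at_top"
    if "n \<in> {1..l}" "k \<in> {1..Suc n}" "m \<in> {1..n}" for n k m
    using im_gam_less[OF assms that(1,3,2)] that
    by (intro tendsto_Gamma1_over) (simp add: gam_eq_Complex)
  have V: "((\<lambda>h. case v of (s, p) \<Rightarrow> of_real h * inverse (Gamma1 ((?g n s - ?g n p) / \<i>) h))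
      \<longlongrightarrow> (case v of (s, p) \<Rightarrow> (?g n s - ?g n p) / \<i>)) at_top" for n v
    by (cases v) (simp only: prod.case tendsto_inverse_Gamma1)
  show ?thesis
    unfolding gt_integrand_def Let_def
    by (intro tendsto_mult tendsto_prod tendsto_divide tendsto_const U V) auto
qed

text \<open>
  Every factor is compared with its limit. Up to constants that depend on the heights of the
  lines, the limits multiply to at most the weight of \<open>elementary_weight_bound\<close>, and what
  remains of the factors to at most the weight of \<open>Gamma_weight_bounded\<close>.
\<close>

lemma gt_integrand_rescaled_dominated:
  assumes "admissible l lam eps"
  shows "\<exists>h0. \<exists>w. integrable (Pi\<^sub>M (triangle l) (\<lambda>_. lborel)) w \<and> (\<forall>h\<ge>h0. \<forall>t.
     norm (gt_integrand (\<lambda>z. Gamma1 z h / of_real h) (\<lambda>z. of_real h * inverse (Gamma1 z h)) l eps lam x t)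
       \<le> w t)"
proof -
  obtain \<delta> D where \<delta>: "0 < \<delta>" "\<delta> \<le> 1"
    and gap: "\<And>n m k. n \<in> {1..l} \<Longrightarrow> m \<in> {1..n} \<Longrightarrow> k \<in> {1..Suc n} \<Longrightarrow>
        \<delta> \<le> im_gam l eps (Suc n) k - im_gam l eps n m"
    and D: "\<And>n j. n \<in> {1..Suc l} \<Longrightarrow> j \<in> {1..n} \<Longrightarrow> \<bar>im_gam l eps n j\<bar> \<le> D"
    using im_gam_bounds[OF assms] by blast
  obtain C where "C > 0" and C: "\<forall>h z D. 1 \<le> h \<longrightarrow> 0 < Re z \<longrightarrow> Re z \<le> D \<longrightarrow> D \<le> h \<longrightarrow>
     norm (Gamma1 z h / of_real h)
       \<le> exp D * C * ((1 + \<bar>Im z\<bar> / h)\<^sup>2 * exp (- (pi * (\<bar>Im z\<bar> / h) / 2))) / norm z"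
    using norm_Gamma1_over_le by (elim exE conjE) (rule that, assumption+)
  obtain K where K: "\<forall>h\<ge>1. \<forall>t. (\<Prod>n=1..l.
     (\<Prod>k=1..n. \<Prod>m=1..Suc n. (1 + \<bar>re_gam l lam t n k - re_gam l lam t (Suc n) m\<bar> / h)\<^sup>2
         * exp (- (pi * (\<bar>re_gam l lam t n k - re_gam l lam t (Suc n) m\<bar> / h) / 2)))
     * (\<Prod>(s, p)\<in>distinct_pairs n. exp (pi * (\<bar>re_gam l lam t n s - re_gam l lam t n p\<bar> / h) / 2))) \<le> K"
    using Gamma_weight_bounded[of l lam] by (elim exE) (rule that, assumption)
  obtain \<beta> B where \<beta>: "\<beta> > 0" and "B > 0" and B: "\<forall>t.
     (\<Prod>n=1..l. (\<Prod>(s, p)\<in>distinct_pairs n. 1 + \<bar>re_gam l lam t n s - re_gam l lam t n p\<bar>)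
               / (\<Prod>k=1..n. \<Prod>m=1..Suc n. 1 + \<bar>re_gam l lam t n k - re_gam l lam t (Suc n) m\<bar>))
     \<le> B * (\<Sum>\<rho>\<in>Pi\<^sub>E (triangle l) (\<lambda>v. {1..Suc (fst v)}). \<Prod>v\<in>triangle l.
       (1 + \<bar>re_gam l lam t (fst v) (snd v) - re_gam l lam t (Suc (fst v)) (\<rho> v)\<bar>) powr - (1 + \<beta>))"
    using elementary_weight_bound[of l lam] by (elim exE conjE) (rule that, assumption+)
  define a where "a = exp (2 * D) * C * (2 / \<delta>)"
  define b where "b = 1 + 2 * \<bar>D\<bar>"
  define c where "c = norm (exp (\<i> * phase l x (gam l lam eps (\<lambda>_. 0))))
      * norm (\<Prod>n=1..l. \<Prod>j=1..n. 1 / (2 * complex_of_real pi))"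
  define A where "A = (\<Prod>n=1..l. a ^ (Suc n * n) * b ^ (n * (n - 1)))"
  have ab: "a > 0" "b > 0" using \<delta> \<open>C > 0\<close> by (auto simp: a_def b_def)
  then have "A > 0" unfolding A_def by (intro prod_pos) auto
  have "c \<ge> 0" by (simp add: c_def)
  define F where "F t = (\<Sum>\<rho>\<in>Pi\<^sub>E (triangle l) (\<lambda>v. {1..Suc (fst v)}). \<Prod>v\<in>triangle l.
       (1 + \<bar>re_gam l lam t (fst v) (snd v) - re_gam l lam t (Suc (fst v)) (\<rho> v)\<bar>) powr - (1 + \<beta>))" for t
  have K0: "K \<ge> 0"
    by (rule order_trans[OF _ K[rule_format, of 1 "\<lambda>_. 0"]])
      (auto simp: case_prod_beta intro!: prod_nonneg mult_nonneg_nonneg)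
  have "norm (gt_integrand (\<lambda>z. Gamma1 z h / of_real h) (\<lambda>z. of_real h * inverse (Gamma1 z h)) l eps lam x t)
       \<le> c * A * K * B * F t" if h: "h \<ge> max 1 (2 * D)" for h t
  proof -
    let ?g = "gam l lam eps t" and ?X = "re_gam l lam t"
    let ?U = "\<lambda>z. Gamma1 z h / of_real h" and ?V = "\<lambda>z. of_real h * inverse (Gamma1 z h)"
    have h1: "h \<ge> 1" "2 * D \<le> h" using h by auto
    define wt where "wt n k m = (1 + \<bar>?X n k - ?X (Suc n) m\<bar> / h)\<^sup>2
         * exp (- (pi * (\<bar>?X n k - ?X (Suc n) m\<bar> / h) / 2))" for n k m
    define we where "we n = (\<lambda>(s, p). exp (pi * (\<bar>?X n s - ?X n p\<bar> / h) / 2))" for n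
    define dt where "dt n k m = 1 + \<bar>?X n k - ?X (Suc n) m\<bar>" for n k m
    define de where "de n = (\<lambda>(s, p). 1 + \<bar>?X n s - ?X n p\<bar>)" for n
    have dpos: "dt n k m > 0" for n k m by (simp add: dt_def add_pos_nonneg)
    have numer: "norm (?U ((?g (Suc n) k - ?g n m) / \<i>)) \<le> a * (wt n m k / dt n m k)"
      if n: "n \<in> {1..l}" "k \<in> {1..Suc n}" "m \<in> {1..n}" for n k m
    proof -
      let ?z = "(?g (Suc n) k - ?g n m) / \<i>"
      have re: "Re ?z = im_gam l eps (Suc n) k - im_gam l eps n m"
        and im: "\<bar>Im ?z\<bar> = \<bar>?X n m - ?X (Suc n) k\<bar>"
        using n by (auto simp: gam_eq_Complex)
      have lower: "\<delta> \<le> Re ?z" unfolding re using gap n by auto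
      have upper: "Re ?z \<le> 2 * D" unfolding re using D[of "Suc n" k] D[of n m] n by auto
      \<comment> \<open>the modulus is at least both \<open>\<delta>\<close> and the distance of the real parts\<close>
      have lower_norm: "\<delta> / 2 * dt n m k \<le> norm ?z"
      proof -
        have "\<delta> \<le> norm ?z" using lower complex_Re_le_cmod[of ?z] by linarith
        moreover have "\<bar>?X n m - ?X (Suc n) k\<bar> \<le> norm ?z" using im abs_Im_le_cmod[of ?z] by linarith
        moreover have "\<delta> * \<bar>?X n m - ?X (Suc n) k\<bar> \<le> 1 * \<bar>?X n m - ?X (Suc n) k\<bar>"
          using \<delta> by (intro mult_right_mono) auto
        ultimately show ?thesis by (simp add: dt_def algebra_simps)
      qed
      have "norm (?U ?z) \<le> exp (2 * D) * C * wt n m k / norm ?z"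
        using C[rule_format, of h ?z "2 * D"] h1 lower upper \<delta> unfolding im wt_def by auto
      also have "\<dots> \<le> exp (2 * D) * C * wt n m k / (\<delta> / 2 * dt n m k)"
      proof (rule divide_left_mono[OF lower_norm])
        have "0 < \<delta> / 2 * dt n m k" using \<delta> dpos[of n m k] by simp
        from mult_pos_pos[OF order_less_le_trans[OF this lower_norm] this]
        show "0 < norm ?z * (\<delta> / 2 * dt n m k)" .
        show "0 \<le> exp (2 * D) * C * wt n m k" using \<open>C > 0\<close> by (simp add: wt_def)
      qed
      also have "\<dots> = a * (wt n m k / dt n m k)" by (simp add: a_def)
      finally show ?thesis .
    qed
    have denom: "(\<Prod>(s, p)\<in>distinct_pairs n. norm (?V ((?g n s - ?g n p) / \<i>)))
        \<le> (\<Prod>v\<in>distinct_pairs n. b * (de n v * we n v))" if n: "n \<in> {1..l}" for n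
    proof (rule prod_distinct_pairs_le)
      fix s p assume sp: "(s, p) \<in> distinct_pairs n"
      let ?z = "(?g n s - ?g n p) / \<i>"
      have ind: "s \<in> {1..n}" "p \<in> {1..n}" using sp by (auto simp: distinct_pairs_def)
      have re: "Re ?z = im_gam l eps n s - im_gam l eps n p"
        and im: "\<bar>Im ?z\<bar> = \<bar>?X n s - ?X n p\<bar>"
        using ind by (auto simp: gam_eq_Complex)
      have "norm ?z \<le> \<bar>Re ?z\<bar> + \<bar>Im ?z\<bar>" by (rule cmod_le)
      also have "\<bar>Re ?z\<bar> \<le> 2 * \<bar>D\<bar>"
        unfolding re using D[of n s] D[of n p] n ind by auto
      also have "2 * \<bar>D\<bar> + \<bar>Im ?z\<bar> \<le> b * de n (s, p)"
        unfolding im by (simp add: b_def de_def algebra_simps)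
      finally have "norm ?z * exp (pi * (\<bar>Im ?z\<bar> / h) / 2) \<le> b * (de n (s, p) * we n (s, p))"
        unfolding im we_def by (simp add: mult.assoc[symmetric])
      then have "(norm ?z * exp (pi * (\<bar>Im ?z\<bar> / h) / 2))\<^sup>2 \<le> (b * (de n (s, p) * we n (s, p)))\<^sup>2"
        by (intro power_mono) auto
      moreover have "- ?z = (?g n p - ?g n s) / \<i>" by (simp add: algebra_simps)
      ultimately show "(case (s, p) of (s, p) \<Rightarrow> norm (?V ((?g n s - ?g n p) / \<i>)))
          * (case (p, s) of (s, p) \<Rightarrow> norm (?V ((?g n s - ?g n p) / \<i>)))
          \<le> (b * (de n (s, p) * we n (s, p)))\<^sup>2"
        using norm_inverse_Gamma1_pair_le[of h ?z] h1 by simp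
    qed (use ab in \<open>auto simp: de_def we_def\<close>)
    have row: "norm ((\<Prod>k=1..Suc n. \<Prod>m=1..n. ?U ((?g (Suc n) k - ?g n m) / \<i>))
        * (\<Prod>(s, p)\<in>distinct_pairs n. ?V ((?g n s - ?g n p) / \<i>)) / fact n)
      \<le> a ^ (Suc n * n) * b ^ (n * (n - 1))
        * (((\<Prod>k=1..n. \<Prod>m=1..Suc n. wt n k m) * prod (we n) (distinct_pairs n))
        * (prod (de n) (distinct_pairs n) / (\<Prod>k=1..n. \<Prod>m=1..Suc n. dt n k m)))"
      (is "norm (?P * ?Q / fact n) \<le> ?R") if n: "n \<in> {1..l}" for n
    proof -
      have "norm ?P \<le> (\<Prod>k=1..Suc n. \<Prod>m=1..n. a * (wt n m k / dt n m k))"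
        unfolding prod_norm[symmetric] using numer n
        by (intro prod_mono conjI prod_nonneg ballI) auto
      also have "\<dots> = (\<Prod>k=1..n. \<Prod>m=1..Suc n. a * (wt n k m / dt n k m))"
        by (rule prod.swap)
      also have "\<dots> = a ^ (Suc n * n) * ((\<Prod>k=1..n. \<Prod>m=1..Suc n. wt n k m) / (\<Prod>k=1..n. \<Prod>m=1..Suc n. dt n k m))"
        by (simp only: prod.distrib prod_dividef prod_constant card_atLeastAtMost diff_Suc_1 power_mult[symmetric])
      finally have P: "norm ?P \<le> \<dots>" .
      have "norm ?Q = (\<Prod>(s, p)\<in>distinct_pairs n. norm (?V ((?g n s - ?g n p) / \<i>)))"
        unfolding prod_norm[symmetric] by (intro prod.cong refl) (auto simp only: prod.case split: prod.split)
      also have "\<dots> \<le> (\<Prod>v\<in>distinct_pairs n. b * (de n v * we n v))" by (rule denom[OF n])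
      also have "\<dots> = b ^ (n * (n - 1)) * (prod (de n) (distinct_pairs n) * prod (we n) (distinct_pairs n))"
        by (simp only: prod.distrib prod_constant card_distinct_pairs)
      finally have Q: "norm ?Q \<le> \<dots>" .
      have "norm (?P * ?Q / fact n) = norm ?P * norm ?Q / fact n"
        by (simp only: norm_divide norm_mult norm_fact)
      also have "\<dots> \<le> norm ?P * norm ?Q / 1"
        by (intro divide_left_mono mult_nonneg_nonneg) (auto simp: fact_ge_1)
      also have "\<dots> \<le> ?R"
        using mult_mono[OF P Q order_trans[OF norm_ge_zero P] norm_ge_zero]
        by (simp only: div_by_1 times_divide_eq_right times_divide_eq_left mult_ac)
      finally show ?thesis .
    qed
    have "norm (\<Prod>n=1..l. (\<Prod>k=1..Suc n. \<Prod>m=1..n. ?U ((?g (Suc n) k - ?g n m) / \<i>))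
        * (\<Prod>(s, p)\<in>distinct_pairs n. ?V ((?g n s - ?g n p) / \<i>)) / fact n)
      \<le> (\<Prod>n=1..l. a ^ (Suc n * n) * b ^ (n * (n - 1))
        * (((\<Prod>k=1..n. \<Prod>m=1..Suc n. wt n k m) * prod (we n) (distinct_pairs n))
        * (prod (de n) (distinct_pairs n) / (\<Prod>k=1..n. \<Prod>m=1..Suc n. dt n k m))))"
      (is "norm ?G \<le> _") unfolding prod_norm[symmetric]
      using row by (intro prod_mono) (auto simp only: norm_ge_zero)
    also have "\<dots> = A * ((\<Prod>n=1..l. (\<Prod>k=1..n. \<Prod>m=1..Suc n. wt n k m) * prod (we n) (distinct_pairs n))
        * (\<Prod>n=1..l. prod (de n) (distinct_pairs n) / (\<Prod>k=1..n. \<Prod>m=1..Suc n. dt n k m)))"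
      unfolding A_def by (simp only: prod.distrib)
    also have "\<dots> \<le> A * (K * (B * F t))"
    proof (intro mult_left_mono mult_mono)
      show "(\<Prod>n=1..l. (\<Prod>k=1..n. \<Prod>m=1..Suc n. wt n k m) * prod (we n) (distinct_pairs n)) \<le> K"
        unfolding wt_def we_def by (rule K[rule_format, OF h1(1)])
      show "(\<Prod>n=1..l. prod (de n) (distinct_pairs n) / (\<Prod>k=1..n. \<Prod>m=1..Suc n. dt n k m)) \<le> B * F t"
        unfolding dt_def de_def F_def by (rule B[rule_format])
      show "0 \<le> (\<Prod>n=1..l. prod (de n) (distinct_pairs n) / (\<Prod>k=1..n. \<Prod>m=1..Suc n. dt n k m))"
        using dpos by (intro prod_nonneg divide_nonneg_nonneg ballI) (auto simp: de_def less_imp_le intro!: prod_nonneg)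
    qed (use K0 \<open>A > 0\<close> in auto)
    finally have "norm ?G \<le> A * (K * (B * F t))" .
    then have "norm ?G * c \<le> A * (K * (B * F t)) * c" using \<open>c \<ge> 0\<close> by (intro mult_right_mono)
    moreover have "norm (gt_integrand ?U ?V l eps lam x t) = norm ?G * c"
      unfolding gt_integrand_def Let_def norm_mult[of "_ * exp _"] norm_mult[of _ "exp _"] norm_exp_phase[of l x lam eps t]
      by (simp only: c_def mult.assoc)
    ultimately show ?thesis by (simp only: mult_ac)
  qed
  then have bound: "\<forall>h\<ge>max 1 (2 * D). \<forall>t.
      norm (gt_integrand (\<lambda>z. Gamma1 z h / of_real h) (\<lambda>z. of_real h * inverse (Gamma1 z h)) l eps lam x t)
       \<le> c * A * K * B * F t" by (intro allI impI)
  have int: "integrable (Pi\<^sub>M (triangle l) (\<lambda>_. lborel)) (\<lambda>t. c * A * K * B * F t)"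
    unfolding F_def using \<beta>
    by (intro integrable_mult_right Bochner_Integration.integrable_sum integrable_forest)
  show ?thesis by (rule exI, rule exI, rule conjI[OF int bound])
qed

theorem proposition3p2:
  fixes l :: nat and lam x :: "nat \<Rightarrow> real" and eps :: "nat \<times> nat \<Rightarrow> real"
  assumes "l \<ge> 1" and "admissible l lam eps"
  shows "((\<lambda>h :: real. of_real (h powr (- (real l * (real l + 1) / 2)))
             * classical_whittaker l eps lam (\<lambda>n. h * x n) h)
          \<longlongrightarrow> elementary_whittaker l eps lam x) at_top"
proof -
  let ?M = "Pi\<^sub>M (triangle l) (\<lambda>_. lborel :: real measure)"
  let ?f = "\<lambda>h. gt_integrand (\<lambda>z. Gamma1 z h / of_real h) (\<lambda>z. of_real h * inverse (Gamma1 z h)) l eps lam x"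
  obtain h0 w where w: "integrable ?M w" "\<And>h t. h \<ge> h0 \<Longrightarrow> norm (?f h t) \<le> w t"
    using gt_integrand_rescaled_dominated[OF assms(2), of x] by blast
  have "((\<lambda>h. LINT t|?M. ?f h t) \<longlongrightarrow> (LINT t|?M. gt_integrand (\<lambda>z. 1 / z) (\<lambda>z. z) l eps lam x t)) at_top"
  proof (rule integral_dominated_convergence_at_top)
    show "\<forall>\<^sub>F h in at_top. AE t in ?M. norm (?f h t) \<le> w t"
      using eventually_ge_at_top[of h0] by eventually_elim (simp add: w(2))
    show "AE t in ?M. ((\<lambda>h. ?f h t) \<longlongrightarrow> gt_integrand (\<lambda>z. 1 / z) (\<lambda>z. z) l eps lam x t) at_top"
      by (intro AE_I2 gt_integrand_rescaled_tendsto assms(2))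
    show "integrable ?M w" by (rule w(1))
    show "?f h \<in> borel_measurable ?M" for h
      by (rule borel_measurable_gt_integrand; measurable)
    show "gt_integrand (\<lambda>z. 1 / z) (\<lambda>z. z) l eps lam x \<in> borel_measurable ?M"
      by (rule borel_measurable_gt_integrand; measurable)
  qed
  moreover have "\<forall>\<^sub>F h in at_top. (LINT t|?M. ?f h t) = of_real (h powr (- (real l * (real l + 1) / 2)))
             * classical_whittaker l eps lam (\<lambda>n. h * x n) h"
    using eventually_gt_at_top[of 0] by eventually_elim (rule classical_whittaker_rescaled[symmetric])
  ultimately show ?thesis
    unfolding elementary_whittaker_eq by (rule Lim_transform_eventually)
qed

end
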